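(* Let $d, m \ge 1$ be integers, let $\Omega \subset \mathbb{R}^d$ be open and bounded, and let $p \ge 1$. Let $h : \mathbb{R}^m \to \mathbb{R}$ be a convex function for which there is a constant $c > 0$ such that $$h(\lambda) \ge \frac{1}{c}|\lambda|^p - c \quad \text{for every } \lambda \in \mathbb{R}^m.$$ Let $\{u_n\}_{n \in \mathbb{N}}$ be a sequence of measurable functions $u_n : \Omega \to \mathbb{R}^m$ satisfying $$\sup_n \int_\Omega h(u_n)\, dx \le C < \infty .$$ Then there exist a subsequence $\{u_{n_k}\}_k$, a parametrized family of probability measures $\{\nu_x\}_{x \in \Omega}$ on $\mathbb{R}^m$ (Young measures), and a concentration measure $\mu$ on $\Omega$ such that: (1) for every continuous function $f : \mathbb{R}^m \to \mathbb{R}$ satisfying $\lim_{|\lambda| \to \infty} \frac{|f(\lambda)|}{1 + |\lambda|^p} = 0$, $$f(u_{n_k}) \rightharpoonup \int_{\mathbb{R}^m} f(\lambda)\, d\nu_x(\lambda) \quad \text{weakly in } L^1(\Omega) \text{ as } k \to \infty;$$ (2) for all $\varphi \in C(\overline{\Omega})$, $$\int_\Omega h(u_{n_k})\, \varphi\, dx \to \int_\Omega \Big( \int_{\mathbb{R}^m} h(\lambda)\, d\nu_x(\lambda) \Big) \varphi(x)\, dx + \int_{\Omega} \varphi \, \mu(dx) \quad \text{as } k \to \infty .$$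
   Context: A parametrized family of probability measures $\{\nu_x\}_{x\in\Omega}$ on $\mathbb{R}^m$ is understood to be weakly measurable: for every bounded continuous $g:\mathbb{R}^m\to\mathbb{R}$ the map $x \mapsto \int g\, d\nu_x$ is Lebesgue measurable on $\Omega$. A concentration measure is a nonnegative finite Borel measure on $\Omega$. All integrals over $\Omega$ with $dx$ are with respect to Lebesgue measure. The function $h$ is bounded below and $\Omega$ has finite measure, so $\int_\Omega h(u_n)\,dx$ is always well defined in $(-\infty,+\infty]$. The right-hand side of (2) includes the implicit assertion that $x \mapsto \int h\, d\nu_x$ belongs to $L^1(\Omega)$.
   Formalization: The concentration measure μ, and the last integral in (2), are taken on the closure of Ω instead of Ω; with μ on Ω the claim fails, e.g. Ω=(0,1), h=|·|, p=1, u_n=n on (0,1/n) and 0 elsewhere, where all mass concentrates at the boundary point 0. *)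

theory Defs
  imports "HOL-Probability.Probability"
begin

text \<open>
  The Bochner integral is \<open>0\<close> on non-integrable functions, so it cannot express the
  bound \<open>\<integral> h(u\<^sub>n) dx \<le> C\<close>, whose left-hand side takes values in \<open>(-\<infinity>, \<infinity>]\<close>.
  For \<open>f\<close> measurable and bounded below on a finite measure space the subtrahend is
  finite, so the ill-defined case \<open>\<infinity> - \<infinity>\<close> does not arise.
\<close>

definition extended_integral :: "'a measure \<Rightarrow> ('a \<Rightarrow> real) \<Rightarrow> ereal" where
  "extended_integral M f =
     enn2ereal (\<integral>\<^sup>+x. ennreal (f x) \<partial>M) - enn2ereal (\<integral>\<^sup>+x. ennreal (- f x) \<partial>M)"

definition young_measure ::
  "(real ^ 'd) set \<Rightarrow> (real ^ 'd \<Rightarrow> (real ^ 'm) measure) \<Rightarrow> bool" where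
  "young_measure \<Omega> \<nu> \<longleftrightarrow>
     (\<forall>x\<in>\<Omega>. prob_space (\<nu> x) \<and> sets (\<nu> x) = sets borel) \<and>
     (\<forall>g :: real ^ 'm \<Rightarrow> real. continuous_on UNIV g \<longrightarrow> bounded (range g) \<longrightarrow>
        (\<lambda>x. LINT l|\<nu> x. g l) \<in> borel_measurable (lebesgue_on \<Omega>))"

text \<open>
  Nonnegativity is built into the type of measures. The underlying space of \<open>\<mu>\<close>
  is \<open>S\<close> itself, so integrals against \<open>\<mu>\<close> are integrals over \<open>S\<close>.
  With test functions in \<open>C(closure \<Omega>)\<close> one needs \<open>S = closure \<Omega>\<close>: mass may
  concentrate on the boundary. For \<open>\<Omega> = (0,1)\<close>, \<open>h = |\<cdot>|\<close> and
  \<open>u\<^sub>n = n\<close> on \<open>(0,1/n)\<close>, \<open>u\<^sub>n = 0\<close> elsewhere, the concentration measure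
  is the unit mass at \<open>0\<close>, and no measure on \<open>\<Omega>\<close> itself will do.
\<close>

definition concentration_measure_on :: "(real ^ 'd) set \<Rightarrow> (real ^ 'd) measure \<Rightarrow> bool" where
  "concentration_measure_on S \<mu> \<longleftrightarrow>
     finite_measure \<mu> \<and> sets \<mu> = sets (restrict_space borel S)"

text \<open>Weak convergence in \<open>L\<^sup>1(M)\<close>: testing against all \<open>g \<in> L\<^sup>\<infinity>(M)\<close>.\<close>

definition weakly_convergent_L1 ::
  "'a measure \<Rightarrow> (nat \<Rightarrow> 'a \<Rightarrow> real) \<Rightarrow> ('a \<Rightarrow> real) \<Rightarrow> bool" where
  "weakly_convergent_L1 M F G \<longleftrightarrow>
     (\<forall>k. integrable M (F k)) \<and> integrable M G \<and>
     (\<forall>g\<in>borel_measurable M. (\<exists>B. AE x in M. \<bar>g x\<bar> \<le> B) \<longrightarrow>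
        (\<lambda>k. LINT x|M. F k x * g x) \<longlonglongrightarrow> (LINT x|M. G x * g x))"

end

theory Submission
  imports Defs
begin

text \<open>
  Every Euclidean space has a Borel coding by real numbers with a continuous left inverse, so Helly's
  selection theorem on the line yields weak sequential compactness of tight sequences of finite
  measures on any Euclidean space. Applied to the laws of \<open>(x, u\<^sub>n x)\<close>, this gives a limit whose
  disintegration over \<open>\<Omega>\<close> is the Young measure; bounded continuous integrands extend to those
  dominated by small multiples of \<open>H = h + 1 + c\<close> by truncation. Applied to the measures
  \<open>H(u\<^sub>n) dx\<close>, it gives a limit \<open>\<rho>\<close> on the closure of \<open>\<Omega>\<close>, and truncation shows
  \<open>\<rho> \<ge> (\<integral> H d\<nu>\<^sub>x) dx\<close>; the concentration measure is the difference.
\<close>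

subsection \<open>Coding Euclidean spaces by real numbers\<close>

text \<open>Selection and disintegration both take place on the real line, where distribution
  functions are available; the coding carries the results to vectors and to the pairs
  \<open>(x, u\<^sub>n x)\<close>. The Young measure is handled as a Borel map \<open>Z\<close>
  rather than as a family of measures, so that iterated integrals become integrals over a product of
  two finite measure spaces and measurability in x comes for free.

  The integrand \<open>h\<close> is out of reach of plain weak convergence. Truncating an integrand
  of slower growth costs an amount that is small uniformly along the sequence, whereas truncating
  \<open>h\<close> may cost a fixed amount, namely the mass of \<open>H(u\<^sub>n)\<close> on the
  sets where \<open>u\<^sub>n\<close> is large. For it only a Fatou inequality survives, and tested
  against nonnegative continuous functions this is exactly the domination that makes the difference
  of the two limits a nonnegative measure. The escaping mass can collect on the boundary, so weak
  limits in x are formed on the whole space and only afterwards located on the closure.\<close>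

definition ternary_bit :: "real \<Rightarrow> real" where
  "ternary_bit t = max 0 (min 1 (3 * t - 1))"

text \<open>On the Cantor set this deletes the leading ternary digit. The ramp of
  \<open>ternary_bit\<close> runs over [1/3, 2/3], whose interior the Cantor set avoids, so digits
  are read exactly by functions that are continuous on the whole line.\<close>

definition ternary_shift :: "real \<Rightarrow> real" where
  "ternary_shift t = 3 * t - 2 * ternary_bit t"

definition cantor_point :: "(nat \<Rightarrow> real) \<Rightarrow> real" where
  "cantor_point b = (\<Sum>k. 2 * b k / 3 ^ Suc k)"

lemma
  assumes b: "\<And>k. b k \<in> {0, 1}"
  shows summable_cantor_point: "summable (\<lambda>k. 2 * b k / 3 ^ Suc k)" (is ?S)
    and cantor_point_nonneg: "0 \<le> cantor_point b"
    and cantor_point_le_1: "cantor_point b \<le> 1"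
proof -
  have g: "(\<lambda>k. (2/3) * (1/3) ^ k :: real) sums 1"
    using sums_mult[OF geometric_sums[of "1/3::real"], of "2/3"] by simp
  have b01: "0 \<le> b k \<and> b k \<le> 1" for k
    using b[of k] by auto
  have le: "norm (2 * b k / 3 ^ Suc k) \<le> (2/3) * (1/3) ^ k" for k
    using b01[of k] by (simp add: field_simps power_divide)
  show S: ?S
    by (rule summable_comparison_test'[OF sums_summable[OF g]]) (rule le)
  show "0 \<le> cantor_point b"
    unfolding cantor_point_def using b01 by (intro suminf_nonneg S) auto
  have "cantor_point b \<le> (\<Sum>k. (2/3) * (1/3) ^ k)"
    unfolding cantor_point_def
    by (intro suminf_le S sums_summable[OF g] order_trans[OF abs_ge_self le[unfolded real_norm_def]])
  then show "cantor_point b \<le> 1"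
    using sums_unique[OF g] by simp
qed

lemma cantor_point_split:
  assumes b: "\<And>k. b k \<in> {0, 1}"
  shows "3 * cantor_point b = 2 * b 0 + cantor_point (\<lambda>k. b (Suc k))"
proof -
  have S: "summable (\<lambda>k. 2 * b (Suc k) / 3 ^ Suc k)"
    using b by (intro summable_cantor_point)
  have "cantor_point b = (\<Sum>k. 2 * b (Suc k) / 3 ^ Suc (Suc k)) + 2 * b 0 / 3"
    unfolding cantor_point_def using suminf_split_head[OF summable_cantor_point[of b, OF b]] by simp
  also have "(\<Sum>k. 2 * b (Suc k) / 3 ^ Suc (Suc k)) = (\<Sum>k. (1/3) * (2 * b (Suc k) / 3 ^ Suc k))"
    by (simp add: field_simps)
  also have "\<dots> = (1/3) * cantor_point (\<lambda>k. b (Suc k))"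
    unfolding cantor_point_def by (rule suminf_mult[OF S])
  finally show ?thesis by simp
qed

text \<open>By the splitting identity the point is 2 * \<open>b 0\<close> / 3 plus a third of a
  number in [0, 1]: it lies in [0, 1/3] or in [2/3, 1] according to the first bit, and there the
  ramp is constant.\<close>

lemma ternary_bit_cantor_point:
  assumes b: "\<And>k. b k \<in> {0, 1}"
  shows "ternary_bit (cantor_point b) = b 0"
proof -
  have "0 \<le> cantor_point (\<lambda>k. b (Suc k))" "cantor_point (\<lambda>k. b (Suc k)) \<le> 1"
    using b by (intro cantor_point_nonneg cantor_point_le_1; blast)+
  then show ?thesis
    using cantor_point_split[of b, OF b] b[of 0] unfolding ternary_bit_def by auto
qed

lemma ternary_shift_cantor_point:
  assumes b: "\<And>k. b k \<in> {0, 1}"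
  shows "ternary_shift (cantor_point b) = cantor_point (\<lambda>k. b (Suc k))"
  using cantor_point_split[of b, OF b] ternary_bit_cantor_point[of b, OF b] unfolding ternary_shift_def by simp

lemma ternary_bit_funpow_shift_cantor_point:
  assumes b: "\<And>k. b k \<in> {0, 1}"
  shows "ternary_bit ((ternary_shift ^^ j) (cantor_point b)) = b j"
proof -
  have "(ternary_shift ^^ j) (cantor_point b) = cantor_point (\<lambda>k. b (k + j))"
    by (induction j) (use b in \<open>auto simp: ternary_shift_cantor_point\<close>)
  then show ?thesis
    using ternary_bit_cantor_point[of "\<lambda>k. b (k + j)"] b by simp
qed

lemma continuous_on_ternary_bit: "continuous_on UNIV (\<lambda>t. ternary_bit ((ternary_shift ^^ j) t))"
proof -
  have 1: "continuous_on UNIV ternary_bit"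
    unfolding ternary_bit_def by (intro continuous_intros)
  have 2: "continuous_on UNIV ternary_shift"
    unfolding ternary_shift_def by (intro continuous_intros 1)
  have "continuous_on UNIV (ternary_shift ^^ j)"
  proof (induction j)
    case (Suc j)
    then show ?case
      using continuous_on_compose[OF Suc continuous_on_subset[OF 2]] by simp
  qed (simp add: id_def)
  from continuous_on_compose[OF this continuous_on_subset[OF 1]] show ?thesis
    by (simp add: o_def)
qed

section \<open>Binary expansions and their continuous recovery from ternary digits\<close>

definition binary_digit :: "nat \<Rightarrow> real \<Rightarrow> real" where
  "binary_digit k y = real_of_int (\<lfloor>2 ^ Suc k * y\<rfloor> - 2 * \<lfloor>2 ^ k * y\<rfloor>)"

lemma binary_digit_01: "binary_digit k y \<in> {0, 1}"
proof -
  define z where "z = 2 ^ k * y"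
  have "\<lfloor>2 * z\<rfloor> - 2 * \<lfloor>z\<rfloor> \<in> {0, 1}"
    by (simp, linarith)
  then show ?thesis
    unfolding binary_digit_def z_def by (auto simp: mult.assoc)
qed

lemma binary_digit_sums:
  assumes y: "0 \<le> y" "y < 1"
  shows "(\<lambda>k. binary_digit k y / 2 ^ Suc k) sums y"
proof -
  have fl: "\<lfloor>y\<rfloor> = 0" using y by linarith
  \<comment> \<open>Telescoping gives the truncation of y to n binary digits; the initial term is
    the floor of y, which is 0 because y lies in [0, 1).\<close>
  have part: "(\<Sum>k<n. binary_digit k y / 2 ^ Suc k) = \<lfloor>2 ^ n * y\<rfloor> / 2 ^ n" for n
    by (induction n) (auto simp: binary_digit_def field_simps fl)
  have "(\<lambda>n. \<lfloor>2 ^ n * y\<rfloor> / 2 ^ n) \<longlonglongrightarrow> y"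
  proof (rule tendsto_sandwich[of "\<lambda>n. y - (1/2) ^ n" _ _ "\<lambda>_. y"])
    show "\<forall>\<^sub>F n in sequentially. y - (1/2) ^ n \<le> \<lfloor>2 ^ n * y\<rfloor> / 2 ^ n"
    proof (intro always_eventually allI)
      fix n
      have "2 ^ n * y - 1 \<le> \<lfloor>2 ^ n * y\<rfloor>" by linarith
      then have "(2 ^ n * y - 1) / 2 ^ n \<le> \<lfloor>2 ^ n * y\<rfloor> / 2 ^ n"
        by (intro divide_right_mono) auto
      then show "y - (1/2) ^ n \<le> \<lfloor>2 ^ n * y\<rfloor> / 2 ^ n"
        by (simp add: diff_divide_distrib power_divide)
    qed
    show "\<forall>\<^sub>F n in sequentially. \<lfloor>2 ^ n * y\<rfloor> / 2 ^ n \<le> y"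
      by (intro always_eventually allI) (simp add: field_simps)
    have "(\<lambda>n. y - (1/2) ^ n) \<longlonglongrightarrow> y - 0"
      by (intro tendsto_intros LIMSEQ_realpow_zero) auto
    then show "(\<lambda>n. y - (1/2) ^ n) \<longlonglongrightarrow> y" by simp
  qed auto
  then show ?thesis
    unfolding sums_def part .
qed

text \<open>\<open>\<iota>\<close> lists the positions of one coordinate in an interleaved
  expansion; reading only these and reassembling them in base 2 undoes the interleaving for that
  coordinate. \<open>ternary_bit\<close> takes values in [0, 1] everywhere, so the series converges
  uniformly on the whole line.\<close>

definition ternary_to_binary :: "(nat \<Rightarrow> nat) \<Rightarrow> real \<Rightarrow> real" where
  "ternary_to_binary \<iota> t = (\<Sum>k. ternary_bit ((ternary_shift ^^ \<iota> k) t) / 2 ^ Suc k)"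

lemma continuous_on_ternary_to_binary: "continuous_on UNIV (ternary_to_binary \<iota>)"
proof -
  let ?f = "\<lambda>k t. ternary_bit ((ternary_shift ^^ \<iota> k) t) / 2 ^ Suc k"
  have "uniform_limit UNIV (\<lambda>n t. \<Sum>k<n. ?f k t) (\<lambda>t. \<Sum>k. ?f k t) sequentially"
  proof (rule Weierstrass_m_test)
    show "norm (?f k t) \<le> (1/2) ^ Suc k" for k t
      by (simp add: ternary_bit_def field_simps power_divide)
    show "summable (\<lambda>k. (1/2) ^ Suc k :: real)"
      by (subst summable_Suc_iff) (simp add: summable_geometric)
  qed
  moreover have "continuous_on UNIV (\<lambda>t. \<Sum>k<n. ?f k t)" for n
    by (intro continuous_intros continuous_on_ternary_bit) auto
  ultimately have "continuous_on UNIV (\<lambda>t. \<Sum>k. ?f k t)"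
    by (intro uniform_limit_theorem[of _ "\<lambda>n t. \<Sum>k<n. ?f k t"]) auto
  then show ?thesis
    unfolding ternary_to_binary_def .
qed

text \<open>The binary digits of the coordinates are interleaved into the ternary digits of a point of
  the Cantor set. The map back is continuous because each digit is locally constant on the Cantor
  set and extends to a continuous function on the line; an even integer added to the code records
  the size of the vector.\<close>

lemma euclidean_real_coding:
  obtains code :: "'a::euclidean_space \<Rightarrow> real" and dec :: "real \<Rightarrow> 'a"
  where "code \<in> borel_measurable borel" "continuous_on UNIV dec" "\<And>y. dec (code y) = y"
    "\<And>y. \<bar>code y\<bar> \<le> 2 * norm y + 5"
proof
  \<comment> \<open>An integer exceeding \<open>norm y\<close>: dividing by it puts all coordinates
    strictly inside (-1, 1), and twice it is an even integer, invisible to a function of period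
    2.\<close>
  define r where "r y = real_of_int \<lceil>norm y\<rceil> + 1" for y :: 'a
  \<comment> \<open>Indices beyond the dimension are sent to some basis vector; their digits are
    stored redundantly and never read.\<close>
  define B where "B n = from_nat_into (Basis :: 'a set) n" for n
  define z where "z y i = ((y \<bullet> i) / r y + 1) / 2" for y i :: 'a
  define b where "b y j = binary_digit (fst (prod_decode j)) (z y (B (snd (prod_decode j))))" for y j
  define code where "code y = 2 * r y + cantor_point (b y)" for y
  \<comment> \<open>The triangle wave of period 2, equal to the identity on [0, 1]: it recovers the
    Cantor part of the code continuously, where a fractional part would jump.\<close>
  define \<tau> where "\<tau> t = arccos (cos (pi * t)) / pi" for t :: real
  define \<iota> where "\<iota> i k = prod_encode (k, to_nat_on (Basis :: 'a set) i)" for i k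
  \<comment> \<open>On a code, \<open>(t - \<tau> t) / 2\<close> is the integer \<open>r y\<close>,
    and doubling and subtracting 1 undoes the affine map in \<open>z\<close>, so the coefficient is
    the original coordinate.\<close>
  define dec where "dec t = (\<Sum>i\<in>Basis. ((t - \<tau> t) / 2 * (2 * ternary_to_binary (\<iota> i) (\<tau> t) - 1)) *\<^sub>R i)"
    for t
  have b01: "b y j \<in> {0, 1}" for y j
    unfolding b_def by (rule binary_digit_01)
  have meas_r: "r \<in> borel_measurable borel"
    unfolding r_def by measurable
  show "code \<in> borel_measurable borel"
    unfolding code_def cantor_point_def b_def binary_digit_def z_def
    by (intro borel_measurable_add borel_measurable_times borel_measurable_suminf) (use meas_r in measurable)
  \<comment> \<open>The even integer is at most 2 * (norm y + 2) and the Cantor part at most 1. This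
    linear bound is what transports tightness to the line.\<close>
  show "\<bar>code y\<bar> \<le> 2 * norm y + 5" for y
  proof -
    have "0 \<le> cantor_point (b y)" "cantor_point (b y) \<le> 1"
      using cantor_point_nonneg[of "b y", OF b01] cantor_point_le_1[of "b y", OF b01] by auto
    moreover have "norm y + 1 \<le> r y" "r y \<le> norm y + 2" "0 \<le> norm y"
      unfolding r_def using ceiling_correct[of "norm y"] by auto
    ultimately show ?thesis
      unfolding code_def by linarith
  qed
  have \<tau>: "continuous_on UNIV \<tau>"
    unfolding \<tau>_def by (intro continuous_intros) auto
  show "continuous_on UNIV dec"
    unfolding dec_def
    by (intro continuous_intros \<tau> continuous_on_compose2[OF continuous_on_ternary_to_binary \<tau>]) auto
  show "dec (code y) = y" for y
  proof -
    let ?D = "cantor_point (b y)"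
    have D: "0 \<le> ?D" "?D \<le> 1"
      using cantor_point_nonneg[of "b y", OF b01] cantor_point_le_1[of "b y", OF b01] by auto
    have "cos (pi * code y) = cos (pi * ?D + of_int (\<lceil>norm y\<rceil> + 1) * (2 * pi))"
      unfolding code_def r_def by (simp add: algebra_simps)
    also have "\<dots> = cos (pi * ?D)"
      unfolding mult.commute[of "of_int _" "2 * pi"] cos_add sin_int_2pin cos_int_2pin by simp
    finally have \<tau>c: "\<tau> (code y) = ?D"
      unfolding \<tau>_def using D by (simp add: arccos_cos mult_le_cancel_left1)
    have r: "norm y < r y" "0 < r y"
      unfolding r_def using norm_ge_zero[of y] by linarith+
    have "ternary_to_binary (\<iota> i) ?D = z y i" if i: "i \<in> Basis" for i
    proof -
      have "b y (\<iota> i k) = binary_digit k (z y i)" for k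
        unfolding b_def \<iota>_def B_def using i by (simp add: countable_finite)
      then have "ternary_to_binary (\<iota> i) ?D = (\<Sum>k. binary_digit k (z y i) / 2 ^ Suc k)"
        unfolding ternary_to_binary_def by (simp add: ternary_bit_funpow_shift_cantor_point[of "b y", OF b01])
      also have "\<dots> = z y i"
      proof (rule sums_unique[symmetric, OF binary_digit_sums])
        have "\<bar>y \<bullet> i\<bar> < r y"
          using Basis_le_norm[OF i, of y] r by simp
        then show "0 \<le> z y i" "z y i < 1"
          unfolding z_def using r by (auto simp: field_simps)
      qed
      finally show ?thesis .
    qed
    then have "dec (code y) = (\<Sum>i\<in>Basis. (r y * (2 * z y i - 1)) *\<^sub>R i)"
      unfolding dec_def \<tau>c by (intro sum.cong) (auto simp: code_def)
    also have "\<dots> = (\<Sum>i\<in>Basis. (y \<bullet> i) *\<^sub>R i)"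
      unfolding z_def using r by (intro sum.cong) (auto simp: field_simps)
    finally show ?thesis
      by (simp add: euclidean_representation)
  qed
qed

subsection \<open>Weak compactness of tight sequences of finite measures\<close>

definition converges_weakly :: "(nat \<Rightarrow> 'a::topological_space measure) \<Rightarrow> 'a measure \<Rightarrow> bool" where
  "converges_weakly M \<rho> \<longleftrightarrow> (\<forall>g :: 'a \<Rightarrow> real. continuous_on UNIV g \<longrightarrow> bounded (range g) \<longrightarrow>
     (\<lambda>n. LINT x|M n. g x) \<longlonglongrightarrow> (LINT x|\<rho>. g x))"

text \<open>Helly's theorem yields a limit \<theta> of the laws of \<open>code\<close>. That
  \<open>code\<close> jumps does no harm: for continuous \<open>g\<close> the composition of
  \<open>g\<close> with \<open>dec\<close> is continuous, and composing it with \<open>code\<close>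
  gives \<open>g\<close> back, so the image of \<theta> under \<open>dec\<close> is a weak limit of
  the original measures.\<close>

lemma tight_prob_weak_compact:
  fixes M :: "nat \<Rightarrow> 'a::euclidean_space measure"
  assumes prob: "\<And>n. prob_space (M n)" and sets [measurable_cong]: "\<And>n. sets (M n) = sets borel"
    and tight: "\<And>\<epsilon>. 0 < \<epsilon> \<Longrightarrow> \<exists>R. \<forall>n. measure (M n) {x. R < norm x} \<le> \<epsilon>"
  obtains s \<rho> where "strict_mono s" "prob_space \<rho>" "sets \<rho> = sets borel" "converges_weakly (\<lambda>n. M (s n)) \<rho>"
proof -
  obtain code :: "'a \<Rightarrow> real" and dec where
    code [measurable]: "code \<in> borel_measurable borel" and cont: "continuous_on UNIV dec"
    and dec_code: "\<And>y. dec (code y) = y" and code_le: "\<And>y. \<bar>code y\<bar> \<le> 2 * norm y + 5"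
    using euclidean_real_coding by blast
  have dec [measurable]: "dec \<in> borel_measurable borel"
    using cont by (rule borel_measurable_continuous_onI)
  have space: "space (M n) = UNIV" for n
    using sets_eq_imp_space_eq[OF sets] by simp
  define \<mu> where "\<mu> n = distr (M n) borel code" for n
  have real: "real_distribution (\<mu> n)" for n
    unfolding \<mu>_def by (rule prob_space.real_distribution_distr[OF prob]) simp
  have "tight \<mu>"
    unfolding tight_def
  proof (intro conjI allI impI real)
    fix \<epsilon> :: real assume "0 < \<epsilon>"
    then obtain R where R: "measure (M n) {x. R < norm x} \<le> \<epsilon> / 2" for n
      using tight[of "\<epsilon> / 2"] by auto
    \<comment> \<open>If \<open>norm x\<close> is at most \<open>R\<close>, then
      \<open>code x\<close> is at most 2 * |R| + 5 in absolute value; one more unit makes the bound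
      strict.\<close>
    define b where "b = 2 * \<bar>R\<bar> + 6"
    have "1 - \<epsilon> < measure (\<mu> n) {-b<..b}" for n
    proof -
      interpret prob_space "M n" by (rule prob)
      have "1 - \<epsilon> < 1 - measure (M n) {x. R < norm x}"
        using R[of n] \<open>0 < \<epsilon>\<close> by simp
      also have "\<dots> = measure (M n) (space (M n) - {x. R < norm x})"
        by (rule prob_compl[symmetric]) measurable
      also have "\<dots> \<le> measure (M n) (code -` {-b<..b} \<inter> space (M n))"
      proof (rule finite_measure_mono)
        show "space (M n) - {x. R < norm x} \<subseteq> code -` {-b<..b} \<inter> space (M n)"
        proof
          fix x assume "x \<in> space (M n) - {x. R < norm x}"
          then have "\<bar>code x\<bar> < b"
            unfolding b_def using code_le[of x] by auto
          then show "x \<in> code -` {-b<..b} \<inter> space (M n)"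
            using space by auto
        qed
      qed measurable
      also have "\<dots> = measure (\<mu> n) {-b<..b}"
        unfolding \<mu>_def by (subst measure_distr) auto
      finally show ?thesis .
    qed
    moreover have "-b < b" unfolding b_def by auto
    ultimately show "\<exists>a b. a < b \<and> (\<forall>n. 1 - \<epsilon> < measure (\<mu> n) {a<..b})"
      by blast
  qed
  then obtain s \<theta> where s: "strict_mono s" and \<theta>: "real_distribution \<theta>" and
    conv: "weak_conv_m (\<mu> \<circ> id \<circ> s) \<theta>"
    using tight_imp_convergent_subsubsequence[of \<mu> id] by (auto simp: strict_mono_def)
  interpret \<theta>: real_distribution \<theta> by fact
  show ?thesis
  proof
    show "strict_mono s" by fact
    show "prob_space (distr \<theta> borel dec)"
      by (rule \<theta>.prob_space_distr) simp
    show "sets (distr \<theta> borel dec) = sets borel" by simp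
    show "converges_weakly (\<lambda>n. M (s n)) (distr \<theta> borel dec)"
      unfolding converges_weakly_def
    proof (intro allI impI)
      fix g :: "'a \<Rightarrow> real" assume g: "continuous_on UNIV g" "bounded (range g)"
      have [measurable]: "g \<in> borel_measurable borel"
        using g(1) by (rule borel_measurable_continuous_onI)
      obtain B where B: "\<bar>g x\<bar> \<le> B" for x
        using g(2) unfolding bounded_iff by auto
      have "continuous_on UNIV (\<lambda>t. g (dec t))"
        using continuous_on_compose2[OF g(1) cont] by auto
      then have "(\<lambda>n. LINT t|\<mu> (s n). g (dec t)) \<longlonglongrightarrow> (LINT t|\<theta>. g (dec t))"
        using weak_conv_imp_integral_bdd_continuous_conv[of "\<mu> \<circ> id \<circ> s" \<theta> "\<lambda>t. g (dec t)" B]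
          real \<theta> conv B by (auto simp: continuous_on_eq_continuous_at)
      then show "(\<lambda>n. LINT x|M (s n). g x) \<longlonglongrightarrow> (LINT x|distr \<theta> borel dec. g x)"
        unfolding \<mu>_def by (simp add: integral_distr dec_code)
    qed
  qed
qed

lemma (in finite_measure) integrable_bounded_range:
  fixes g :: "'a \<Rightarrow> real"
  assumes "g \<in> borel_measurable M" "bounded (range g)"
  shows "integrable M g"
proof -
  obtain B where "\<bar>g x\<bar> \<le> B" for x
    using assms(2) unfolding bounded_iff by auto
  then show ?thesis
    using assms(1) by (intro integrable_const_bound[where B=B]) auto
qed

text \<open>Along a subsequence the masses converge to some l. If l = 0, the integrals of bounded
  functions tend to 0 and the null measure is the limit; otherwise the measures are normalised and
  the limiting probability is multiplied by l.\<close>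

theorem tight_finite_measures_weak_compact:
  fixes M :: "nat \<Rightarrow> 'a::euclidean_space measure"
  assumes fin: "\<And>n. finite_measure (M n)" and sets [measurable_cong]: "\<And>n. sets (M n) = sets borel"
    and bdd: "\<And>n. measure (M n) UNIV \<le> K"
    and tight: "\<And>\<epsilon>. 0 < \<epsilon> \<Longrightarrow> \<exists>R. \<forall>n. measure (M n) {x. R < norm x} \<le> \<epsilon>"
  obtains s \<rho> where "strict_mono s" "finite_measure \<rho>" "sets \<rho> = sets borel" "converges_weakly (\<lambda>n. M (s n)) \<rho>"
proof -
  define m where "m n = measure (M n) UNIV" for n
  have space: "space (M n) = UNIV" for n
    using sets_eq_imp_space_eq[OF sets] by simp
  have "bounded (range m)"
    unfolding bounded_iff m_def using bdd by (auto intro!: exI[of _ K])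
  then obtain l r where r: "strict_mono (r :: nat \<Rightarrow> nat)" and lim: "(m \<circ> r) \<longlonglongrightarrow> l"
    using bounded_imp_convergent_subsequence by blast
  have "0 \<le> l"
    using lim by (rule LIMSEQ_le_const) (auto simp: m_def)
  show ?thesis
  proof (cases "l = 0")
    case True
    show ?thesis
    proof
      show "strict_mono r" by fact
      show "finite_measure (null_measure (borel :: 'a measure))" by (rule finite_measureI) simp
      show "sets (null_measure (borel :: 'a measure)) = sets borel" by simp
      show "converges_weakly (\<lambda>n. M (r n)) (null_measure borel)"
        unfolding converges_weakly_def
      proof (intro allI impI)
        fix g :: "'a \<Rightarrow> real" assume g: "continuous_on UNIV g" "bounded (range g)"
        have [measurable]: "g \<in> borel_measurable borel"
          using g(1) by (rule borel_measurable_continuous_onI)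
        obtain B where B: "\<bar>g x\<bar> \<le> B" for x
          using g(2) unfolding bounded_iff by auto
        have "\<bar>LINT x|M (r n). g x\<bar> \<le> B * m (r n)" for n
        proof -
          interpret finite_measure "M (r n)" by (rule fin)
          have "\<bar>LINT x|M (r n). g x\<bar> \<le> (LINT x|M (r n). B)"
            using B by (intro integral_abs_bound_integral integrable_bounded_range g) auto
          then show ?thesis
            by (simp add: m_def space mult.commute)
        qed
        moreover have "(\<lambda>n. B * m (r n)) \<longlonglongrightarrow> B * 0"
          using lim True by (intro tendsto_intros) (simp add: o_def)
        ultimately have "(\<lambda>n. LINT x|M (r n). g x) \<longlonglongrightarrow> 0"
          using Lim_null_comparison[of "\<lambda>n. LINT x|M (r n). g x" "\<lambda>n. B * m (r n)" sequentially]
          by simp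
        moreover have "(LINT x|null_measure borel. g x) = 0"
          by (intro integral_eq_zero_AE AE_I'[of UNIV]) (auto simp: null_sets_def)
        ultimately show "(\<lambda>n. LINT x|M (r n). g x) \<longlonglongrightarrow> (LINT x|null_measure borel. g x)"
          by simp
      qed
    qed
  next
    case False
    with \<open>0 \<le> l\<close> have l: "0 < l" by simp
    then have "\<forall>\<^sub>F n in sequentially. l / 2 < m (r n)"
      using order_tendstoD(1)[OF lim, of "l / 2"] by simp
    then obtain N where N: "\<And>n. N \<le> n \<Longrightarrow> l / 2 < m (r n)"
      unfolding eventually_sequentially by auto
    \<comment> \<open>Dropping the first \<open>N\<close> terms keeps every mass above
      \<open>l / 2\<close>, so division by the mass costs tightness only a fixed factor.\<close>
    define q where "q n = r (n + N)" for n
    have q: "strict_mono q"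
      using r unfolding q_def strict_mono_def by simp
    have mq: "l / 2 < m (q n)" "0 < m (q n)" for n
      using N[of "n + N"] l unfolding q_def by auto
    define D where "D n = density (M (q n)) (\<lambda>_. ennreal (1 / m (q n)))" for n
    have mD: "measure (D n) A = measure (M (q n)) A / m (q n)" if "A \<in> sets borel" for A n
      unfolding D_def using that mq[of n] sets
      by (simp add: measure_def emeasure_density_const enn2real_mult)
    have D_prob: "prob_space (D n)" for n
    proof
      interpret finite_measure "M (q n)" by (rule fin)
      show "emeasure (D n) (space (D n)) = 1"
        unfolding D_def using mq[of n]
        by (simp add: emeasure_density_const space emeasure_eq_measure m_def
            flip: ennreal_mult)
    qed
    have D_sets: "sets (D n) = sets borel" for n
      unfolding D_def using sets by simp
    have D_tight: "\<exists>R. \<forall>n. measure (D n) {x. R < norm x} \<le> \<epsilon>" if "0 < \<epsilon>" for \<epsilon>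
    proof -
      have "0 < \<epsilon> * (l / 2)" using that l by simp
      from tight[OF this] obtain R where R: "\<And>n. measure (M n) {x. R < norm x} \<le> \<epsilon> * (l / 2)"
        by blast
      have "measure (D n) {x. R < norm x} \<le> \<epsilon>" for n
      proof -
        have "\<epsilon> * (l / 2) \<le> \<epsilon> * m (q n)"
          using mq[of n] that by (intro mult_left_mono) auto
        then show ?thesis
          using R[of "q n"] mq[of n] by (subst mD) (auto simp: divide_le_eq)
      qed
      then show ?thesis by blast
    qed
    obtain s P where s: "strict_mono s" and P: "prob_space P" and
      sP [measurable_cong]: "sets P = sets borel" and
      conv: "converges_weakly (\<lambda>n. D (s n)) P"
      by (rule tight_prob_weak_compact[of D, OF D_prob D_sets D_tight])
    interpret P: prob_space P by fact
    show ?thesis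
    proof
      show "strict_mono (q \<circ> s)"
        using q s by (rule strict_mono_o)
      show "finite_measure (density P (\<lambda>_. ennreal l))"
        by (rule finite_measureI) (simp add: emeasure_density_const P.emeasure_space_1)
      show "sets (density P (\<lambda>_. ennreal l)) = sets borel"
        using sP by simp
      show "converges_weakly (\<lambda>n. M ((q \<circ> s) n)) (density P (\<lambda>_. ennreal l))"
        unfolding converges_weakly_def
      proof (intro allI impI)
        fix g :: "'a \<Rightarrow> real" assume g: "continuous_on UNIV g" "bounded (range g)"
        have [measurable]: "g \<in> borel_measurable borel"
          using g(1) by (rule borel_measurable_continuous_onI)
        have "(LINT x|M ((q \<circ> s) n). g x) = m (q (s n)) * (LINT x|D (s n). g x)" for n
          unfolding D_def using mq[of "s n"] by (subst integral_density) auto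
        moreover have "(\<lambda>n. m (q (s n)) * (LINT x|D (s n). g x)) \<longlonglongrightarrow> l * (LINT x|P. g x)"
        proof (intro tendsto_mult conv[unfolded converges_weakly_def, rule_format] g)
          have "(\<lambda>n. (m \<circ> r) (s n + N)) \<longlonglongrightarrow> l"
            using LIMSEQ_subseq_LIMSEQ[OF LIMSEQ_ignore_initial_segment[OF lim, of N] s]
            by (simp add: o_def)
          then show "(\<lambda>n. m (q (s n))) \<longlonglongrightarrow> l"
            unfolding q_def by simp
        qed
        moreover have "(LINT x|density P (\<lambda>_. ennreal l). g x) = l * (LINT x|P. g x)"
          using l by (subst integral_density) auto
        ultimately show "(\<lambda>n. LINT x|M ((q \<circ> s) n). g x) \<longlonglongrightarrow> (LINT x|density P (\<lambda>_. ennreal l). g x)"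
          by simp
      qed
    qed
  qed
qed

subsection \<open>Disintegration\<close>

text \<open>Tested on the set where \<open>g < f\<close>: there the integral of \<open>f\<close> is
  at most that of \<open>g\<close>, so the positive function f - g has integral 0 over it.
  Finiteness of the integral of \<open>g\<close> makes the subtraction legitimate.\<close>

lemma AE_le_of_set_nn_integral_le:
  fixes f g :: "'a \<Rightarrow> ennreal"
  assumes [measurable]: "f \<in> borel_measurable M" "g \<in> borel_measurable M"
    and fin: "(\<integral>\<^sup>+x. g x \<partial>M) \<noteq> \<infinity>"
    and le: "\<And>A. A \<in> sets M \<Longrightarrow> (\<integral>\<^sup>+x\<in>A. f x \<partial>M) \<le> (\<integral>\<^sup>+x\<in>A. g x \<partial>M)"
  shows "AE x in M. f x \<le> g x"
proof -
  let ?A = "{x\<in>space M. g x < f x}"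
  have A [measurable]: "?A \<in> sets M" by measurable
  have "(\<integral>\<^sup>+x. f x * indicator ?A x - g x * indicator ?A x \<partial>M) =
      (\<integral>\<^sup>+x\<in>?A. f x \<partial>M) - (\<integral>\<^sup>+x\<in>?A. g x \<partial>M)"
  proof (rule nn_integral_diff)
    have "(\<integral>\<^sup>+x\<in>?A. g x \<partial>M) \<le> (\<integral>\<^sup>+x. g x \<partial>M)"
      by (intro nn_integral_mono) (auto split: split_indicator)
    then show "(\<integral>\<^sup>+x\<in>?A. g x \<partial>M) \<noteq> \<infinity>"
      using fin by (auto simp: top_unique)
  qed (auto split: split_indicator)
  also have "\<dots> = 0"
  proof (rule diff_eq_0_ennreal)
    have "(\<integral>\<^sup>+x\<in>?A. g x \<partial>M) \<le> (\<integral>\<^sup>+x. g x \<partial>M)"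
      by (intro nn_integral_mono) (auto split: split_indicator)
    then show "(\<integral>\<^sup>+x\<in>?A. f x \<partial>M) < \<top>"
      using le[OF A] fin by (auto simp: less_top[symmetric] top_unique)
  qed (rule le[OF A])
  finally have "AE x in M. f x * indicator ?A x - g x * indicator ?A x = 0"
    by (subst (asm) nn_integral_0_iff_AE) auto
  with AE_space show ?thesis
  proof eventually_elim
    case (elim x)
    then have "f x - g x = 0" if "g x < f x"
      using that by simp
    then show ?case
      by (metis diff_gt_0_iff_gt_ennreal less_irrefl not_less)
  qed
qed

abbreviation unit_uniform :: "real measure" where
  "unit_uniform \<equiv> uniform_measure lborel {0<..<1}"

lemma prob_space_unit_uniform: "prob_space unit_uniform"
  by (rule prob_space_uniform_measure) auto

text \<open>Sublevel sets of a quantile function are initial segments of (0, 1) whose right endpoint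
  may or may not belong to them, hence the sandwich; points outside (0, 1) carry no mass.\<close>

lemma emeasure_unit_uniform_initial_segment:
  assumes B [measurable]: "B \<in> sets borel" and r: "0 \<le> r" "r \<le> 1"
    and lower: "{0<..<r} \<subseteq> B" and upper: "\<And>\<omega>. \<omega> \<in> B \<Longrightarrow> 0 < \<omega> \<Longrightarrow> \<omega> < 1 \<Longrightarrow> \<omega> \<le> r"
  shows "emeasure unit_uniform B = ennreal r"
proof (rule antisym)
  have eq: "emeasure unit_uniform B = emeasure lborel ({0<..<1} \<inter> B)"
    by (subst emeasure_uniform_measure) (auto simp: divide_ennreal_def)
  have "emeasure lborel ({0<..<1} \<inter> B) \<le> emeasure lborel {0..r}"
    using upper by (intro emeasure_mono) auto
  then show "emeasure unit_uniform B \<le> ennreal r"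
    unfolding eq using r by simp
  have "emeasure lborel {0<..<r} \<le> emeasure lborel ({0<..<1} \<inter> B)"
    using lower r by (intro emeasure_mono) auto
  then show "ennreal r \<le> emeasure unit_uniform B"
    unfolding eq using r by simp
qed

text \<open>The second coordinate is generated from the first one and an independent uniform variable
  through the quantile function of the conditional distribution. The conditional distribution
  functions themselves are Radon-Nikodym derivatives.\<close>

lemma real_pair_parametrization:
  fixes Q :: "('a \<times> real) measure"
  assumes Q: "finite_measure Q" and sQ: "sets Q = sets (N \<Otimes>\<^sub>M borel)"
  obtains Y where "Y \<in> borel_measurable (N \<Otimes>\<^sub>M unit_uniform)"
    "Q = distr (distr Q N fst \<Otimes>\<^sub>M unit_uniform) (N \<Otimes>\<^sub>M borel) (\<lambda>(x, \<omega>). (x, Y (x, \<omega>)))"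
proof -
  note [measurable_cong] = sQ
  interpret Q: finite_measure Q by fact
  interpret U: prob_space unit_uniform by (rule prob_space_unit_uniform)
  have spQ: "space Q = space N \<times> UNIV"
    using sets_eq_imp_space_eq[OF sQ] by (simp add: space_pair_measure)
  define P where "P = distr Q N fst"
  interpret P: finite_measure P
    unfolding P_def by (rule Q.finite_measure_distr) simp
  have sP [measurable_cong, simp]: "sets P = sets N" and spP [simp]: "space P = space N"
    unfolding P_def by simp_all
  have P_eq: "emeasure P A = emeasure Q (A \<times> UNIV)" if "A \<in> sets N" for A
    unfolding P_def using that sets.sets_into_space[OF that]
    by (subst emeasure_distr) (auto simp: spQ intro!: arg_cong[where f="emeasure Q"])
  have "\<exists>f \<in> borel_measurable N. \<forall>A\<in>sets N. (\<integral>\<^sup>+x\<in>A. f x \<partial>P) = emeasure Q (A \<times> {..<t})" for t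
  proof -
    \<comment> \<open>The part of \<open>Q\<close> with second coordinate below \<open>t\<close>,
      projected to the first: its density with respect to the marginal is a version of the
      conditional probability of lying below \<open>t\<close> given x.\<close>
    define R where "R = distr (density Q (indicator (space N \<times> {..<t}))) N fst"
    have R: "emeasure R A = emeasure Q (A \<times> {..<t})" if [measurable]: "A \<in> sets N" for A
    proof -
      have "emeasure R A = (\<integral>\<^sup>+z. indicator (space N \<times> {..<t}) z * indicator (fst -` A \<inter> space Q) z \<partial>Q)"
        unfolding R_def by (subst emeasure_distr) (auto simp: emeasure_density)
      also have "\<dots> = (\<integral>\<^sup>+z. indicator (A \<times> {..<t}) z \<partial>Q)"
        using sets.sets_into_space[OF that]
        by (intro nn_integral_cong) (auto simp: spQ split: split_indicator)
      finally show ?thesis by simp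
    qed
    have "absolutely_continuous P R"
      unfolding absolutely_continuous_def
    proof
      fix A assume "A \<in> null_sets P"
      then have A [measurable]: "A \<in> sets N" and "emeasure Q (A \<times> UNIV) = 0"
        by (auto simp: null_sets_def P_eq)
      moreover have "emeasure Q (A \<times> {..<t}) \<le> emeasure Q (A \<times> UNIV)"
        by (intro emeasure_mono) (auto simp: sQ)
      ultimately show "A \<in> null_sets R"
        by (auto simp: null_sets_def R R_def[THEN arg_cong[where f=sets]])
    qed
    then obtain f where f: "f \<in> borel_measurable P" "density P f = R"
      using P.Radon_Nikodym[of R] by (auto simp: R_def)
    then have "(\<integral>\<^sup>+x\<in>A. f x \<partial>P) = emeasure Q (A \<times> {..<t})" if "A \<in> sets N" for A
      using R[OF that] that by (simp add: emeasure_density flip: f(2))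
    moreover have "f \<in> borel_measurable N"
      using f(1) measurable_cong_sets[OF sP refl, of borel] by simp
    ultimately show ?thesis by blast
  qed
  then obtain F where F_meas [measurable]: "\<And>t. F t \<in> borel_measurable N"
    and F: "\<And>t A. A \<in> sets N \<Longrightarrow> (\<integral>\<^sup>+x\<in>A. F t x \<partial>P) = emeasure Q (A \<times> {..<t})"
    by metis
  have F_fin: "(\<integral>\<^sup>+x. F t x \<partial>P) \<noteq> \<infinity>" for t
  proof -
    have "(\<integral>\<^sup>+x. F t x \<partial>P) = (\<integral>\<^sup>+x\<in>space N. F t x \<partial>P)"
      by (intro nn_integral_cong) auto
    then show ?thesis using F[of "space N" t] by simp
  qed
  \<comment> \<open>Each \<open>F t\<close> is determined only up to a null set depending on
    \<open>t\<close>. Monotonicity, the limits at both infinities and left continuity are therefore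
    proved for fixed or countably many arguments and combined later.\<close>
  have F_mono: "AE x in P. F s x \<le> F t x" if "s \<le> t" for s t
    using that F_fin[of t]
    by (intro AE_le_of_set_nn_integral_le) (auto simp: F sQ intro!: emeasure_mono)
  have F_le_1: "AE x in P. F t x \<le> 1" for t
    by (intro AE_le_of_set_nn_integral_le) (auto simp: F sQ P_eq intro!: emeasure_mono)
  have F_top: "AE x in P. 1 \<le> (SUP n. F (real n) x)"
  proof (rule AE_le_of_set_nn_integral_le)
    have "AE x in P. \<forall>n. F (real n) x \<le> 1"
      using F_le_1 by (simp add: AE_all_countable)
    then have "(\<integral>\<^sup>+x. (SUP n. F (real n) x) \<partial>P) \<le> (\<integral>\<^sup>+x. 1 \<partial>P)"
      by (intro nn_integral_mono_AE) (auto elim!: eventually_mono intro: SUP_least)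
    then show "(\<integral>\<^sup>+x. (SUP n. F (real n) x) \<partial>P) \<noteq> \<infinity>"
      by (auto simp: top_unique)
  next
    fix A assume "A \<in> sets P"
    then have A [measurable]: "A \<in> sets N" by simp
    have "(\<integral>\<^sup>+x\<in>A. 1 \<partial>P) = emeasure Q (\<Union>n. A \<times> {..<real n})"
      using A by (auto simp: P_eq reals_Archimedean2 intro!: arg_cong[where f="emeasure Q"])
    also have "\<dots> = (SUP n. emeasure Q (A \<times> {..<real n}))"
      by (intro SUP_emeasure_incseq[symmetric]) (auto simp: sQ incseq_def)
    also have "\<dots> = (SUP n. \<integral>\<^sup>+x\<in>A. F (real n) x \<partial>P)"
      by (simp add: F)
    also have "\<dots> \<le> (\<integral>\<^sup>+x\<in>A. (SUP n. F (real n) x) \<partial>P)"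
      by (intro SUP_least nn_integral_mono mult_right_mono SUP_upper) auto
    finally show "(\<integral>\<^sup>+x\<in>A. 1 \<partial>P) \<le> (\<integral>\<^sup>+x\<in>A. (SUP n. F (real n) x) \<partial>P)" .
  qed measurable
  have F_bot: "AE x in P. (INF n. F (- real n) x) \<le> 0"
  proof (rule AE_le_of_set_nn_integral_le)
    fix A assume "A \<in> sets P"
    then have A [measurable]: "A \<in> sets N" by simp
    have "(\<integral>\<^sup>+x\<in>A. (INF n. F (- real n) x) \<partial>P) \<le> (INF n. \<integral>\<^sup>+x\<in>A. F (- real n) x \<partial>P)"
      by (intro INF_greatest nn_integral_mono mult_right_mono INF_lower) auto
    also have "\<dots> = (INF n. emeasure Q (A \<times> {..<- real n}))"
      by (simp add: F)
    also have "\<dots> = emeasure Q (\<Inter>n. A \<times> {..<- real n})"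
      by (intro INF_emeasure_decseq) (auto simp: sQ decseq_def)
    also have "(\<Inter>n. A \<times> {..<- real n}) = {}"
    proof -
      have "\<exists>n. \<not> y < - real n" for y
        using reals_Archimedean2[of "- y"] by (metis minus_less_iff not_less_iff_gr_or_eq)
      then show ?thesis by blast
    qed
    finally show "(\<integral>\<^sup>+x\<in>A. (INF n. F (- real n) x) \<partial>P) \<le> (\<integral>\<^sup>+x\<in>A. 0 \<partial>P)" by simp
  qed auto
  \<comment> \<open>The strict inequality in \<open>{..<t}\<close> makes the distribution functions
    left continuous. Only rational arguments enter the supremum, which keeps it measurable and the
    exceptional sets countable in number.\<close>
  have F_left: "AE x in P. F t x \<le> (SUP q\<in>{q \<in> \<rat>. q < t}. F q x)" for t
  proof (rule AE_le_of_set_nn_integral_le)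
    have cnt: "countable {q \<in> \<rat>. q < t}"
      by (rule countable_subset[OF _ countable_rat]) auto
    show [measurable]: "(\<lambda>x. SUP q\<in>{q \<in> \<rat>. q < t}. F q x) \<in> borel_measurable P"
      by (intro borel_measurable_SUP cnt) auto
    have "AE x in P. \<forall>q\<in>{q \<in> \<rat>. q < t}. F q x \<le> 1"
      using F_le_1 by (subst AE_ball_countable[OF cnt]) auto
    then have "(\<integral>\<^sup>+x. (SUP q\<in>{q \<in> \<rat>. q < t}. F q x) \<partial>P) \<le> (\<integral>\<^sup>+x. 1 \<partial>P)"
      by (intro nn_integral_mono_AE) (auto elim!: eventually_mono intro: SUP_least)
    then show "(\<integral>\<^sup>+x. (SUP q\<in>{q \<in> \<rat>. q < t}. F q x) \<partial>P) \<noteq> \<infinity>"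
      by (auto simp: top_unique)
    fix A assume "A \<in> sets P"
    then have A [measurable]: "A \<in> sets N" by simp
    define s where "s n = t - 1 / real (Suc n)" for n
    have "(\<integral>\<^sup>+x\<in>A. F t x \<partial>P) = emeasure Q (\<Union>n. A \<times> {..<s n})"
    proof -
      have "\<exists>n. y < s n" if "y < t" for y
      proof -
        obtain n where "inverse (real (Suc n)) < t - y"
          using reals_Archimedean[of "t - y"] \<open>y < t\<close> by auto
        then show ?thesis
          unfolding s_def by (intro exI[of _ n]) (simp add: inverse_eq_divide)
      qed
      moreover have "y < t" if "y < s n" for y n
        using that unfolding s_def by (smt (verit) divide_pos_pos of_nat_0_less_iff zero_less_Suc)
      ultimately have "A \<times> {..<t} = (\<Union>n. A \<times> {..<s n})" by auto
      then show ?thesis using F[OF A] by simp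
    qed
    also have "\<dots> = (SUP n. emeasure Q (A \<times> {..<s n}))"
    proof (intro SUP_emeasure_incseq[symmetric])
      have "s m \<le> s n" if "m \<le> n" for m n
        using that unfolding s_def by (auto simp: frac_le)
      then show "incseq (\<lambda>n. A \<times> {..<s n})"
        by (fastforce simp: incseq_def)
    qed (auto simp: sQ)
    also have "\<dots> \<le> (\<integral>\<^sup>+x\<in>A. (SUP q\<in>{q \<in> \<rat>. q < t}. F q x) \<partial>P)"
    proof (rule SUP_least)
      fix n
      obtain q where q: "q \<in> \<rat>" "s n < q" "q < t"
        using Rats_dense_in_real[of "s n" t] unfolding s_def by auto
      have "emeasure Q (A \<times> {..<s n}) \<le> (\<integral>\<^sup>+x\<in>A. F q x \<partial>P)"
        using q by (subst F) (auto simp: sQ intro!: emeasure_mono)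
      also have "\<dots> \<le> (\<integral>\<^sup>+x\<in>A. (SUP q\<in>{q \<in> \<rat>. q < t}. F q x) \<partial>P)"
        using q by (intro nn_integral_mono mult_right_mono SUP_upper) auto
      finally show "emeasure Q (A \<times> {..<s n}) \<le> (\<integral>\<^sup>+x\<in>A. (SUP q\<in>{q \<in> \<rat>. q < t}. F q x) \<partial>P)" .
    qed
    finally show "(\<integral>\<^sup>+x\<in>A. F t x \<partial>P) \<le> (\<integral>\<^sup>+x\<in>A. (SUP q\<in>{q \<in> \<rat>. q < t}. F q x) \<partial>P)" .
  qed auto
  \<comment> \<open>The quantile function, with the infimum over rationals to keep it measurable.
    Extended values allow for an empty or unbounded set of admissible \<open>q\<close>, which occurs
    only on null sets; \<open>real_of_ereal\<close> gives 0 there.\<close>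
  define Z where "Z z = (INF q\<in>\<rat>. if ennreal (snd z) \<le> F q (fst z) then ereal q else \<infinity>)"
    for z :: "'a \<times> real"
  define Y where "Y z = real_of_ereal (Z z)" for z
  have [measurable]: "Z \<in> borel_measurable (N \<Otimes>\<^sub>M unit_uniform)"
    unfolding Z_def by (intro borel_measurable_INF countable_rat) measurable
  have Y [measurable]: "Y \<in> borel_measurable (N \<Otimes>\<^sub>M unit_uniform)"
    unfolding Y_def by measurable
  \<comment> \<open>The exceptional set may depend on \<open>t\<close>, which is enough: the two
    measures are compared on rectangles \<open>A \<times> {..<t}\<close>, one \<open>t\<close> at a
    time.\<close>
  have key: "AE x in P. emeasure unit_uniform {\<omega>. Y (x, \<omega>) < t} = F t x" for t
  proof -
    have "AE x in P. \<forall>s\<in>\<rat>. \<forall>r\<in>\<rat>. s \<le> r \<longrightarrow> F s x \<le> F r x"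
      unfolding AE_ball_countable[OF countable_rat] using F_mono by auto
    moreover have "AE x in P. \<forall>s\<in>\<rat>. s \<le> t \<longrightarrow> F s x \<le> F t x"
      unfolding AE_ball_countable[OF countable_rat] using F_mono by auto
    moreover note F_top F_bot F_left[of t] F_le_1[of t] AE_space[of P]
    ultimately show ?thesis
    proof eventually_elim
      case (elim x)
      then have x [measurable]: "x \<in> space N" by simp
      obtain r where r: "F t x = ennreal r" "0 \<le> r" "r \<le> 1"
        using elim(6) by (cases "F t x") (auto simp: top_unique)
      have Y_less: "Y (x, \<omega>) < t \<longleftrightarrow> (\<exists>q\<in>\<rat>. q < t \<and> ennreal \<omega> \<le> F q x)"
        if \<omega>: "0 < \<omega>" "\<omega> < 1" for \<omega>
      proof -
        \<comment> \<open>The values of \<open>F\<close> have supremum at least 1 along the positive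
          integers and infimum 0 along the negative ones; since \<omega> lies strictly between 0 and
          1, this makes \<open>Z\<close> finite.\<close>
        have "ennreal \<omega> < (SUP n. F (real n) x)"
          using elim(3) \<omega> by (intro less_le_trans[OF _ elim(3)]) (simp add: ennreal_less_one_iff)
        then obtain n where n: "ennreal \<omega> \<le> F (real n) x"
          by (auto simp: less_SUP_iff dest: less_imp_le)
        have "(INF n. F (- real n) x) < ennreal \<omega>"
          using \<omega> by (intro le_less_trans[OF elim(4)]) simp
        then obtain m where m: "F (- real m) x < ennreal \<omega>"
          by (auto simp: INF_less_iff)
        have "Z (x, \<omega>) \<le> ereal (real n)"
          unfolding Z_def using n by (intro INF_lower2[of "real n"]) auto
        moreover have "ereal (- real m) \<le> Z (x, \<omega>)"
          unfolding Z_def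
        proof (rule INF_greatest)
          fix q :: real assume q: "q \<in> \<rat>"
          have "- real m \<in> \<rat>" by simp
          then have "F q x \<le> F (- real m) x" if "q \<le> - real m"
            using elim(1) q that by blast
          then have "- real m \<le> q" if "ennreal \<omega> \<le> F q x"
            using m that by (meson leD le_less_trans linear order.trans)
          then show "ereal (- real m) \<le> (if ennreal (snd (x, \<omega>)) \<le> F q (fst (x, \<omega>)) then ereal q else \<infinity>)"
            by auto
        qed
        ultimately have "Y (x, \<omega>) < t \<longleftrightarrow> Z (x, \<omega>) < ereal t"
          unfolding Y_def by (cases "Z (x, \<omega>)") auto
        also have "\<dots> \<longleftrightarrow> (\<exists>q\<in>\<rat>. q < t \<and> ennreal \<omega> \<le> F q x)"
          unfolding Z_def INF_less_iff by (auto split: if_splits)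
        finally show ?thesis .
      qed
      show ?case
        unfolding r(1)
      proof (rule emeasure_unit_uniform_initial_segment)
        have "{\<omega>\<in>space unit_uniform. Y (x, \<omega>) < t} \<in> sets unit_uniform" by measurable
        then show "{\<omega>. Y (x, \<omega>) < t} \<in> sets borel" by simp
        show "{0<..<r} \<subseteq> {\<omega>. Y (x, \<omega>) < t}"
        proof
          fix \<omega> assume \<omega>: "\<omega> \<in> {0<..<r}"
          then have "ennreal \<omega> < ennreal r" by (simp add: ennreal_less_iff)
          then have "ennreal \<omega> < (SUP q\<in>{q \<in> \<rat>. q < t}. F q x)"
            using elim(5) r(1) by (metis less_le_trans)
          then show "\<omega> \<in> {\<omega>. Y (x, \<omega>) < t}"
            using \<omega> r Y_less[of \<omega>] by (auto simp: less_SUP_iff dest: less_imp_le)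
        qed
        fix \<omega> assume "\<omega> \<in> {\<omega>. Y (x, \<omega>) < t}" "0 < \<omega>" "\<omega> < 1"
        then obtain q where "q \<in> \<rat>" "q < t" "ennreal \<omega> \<le> F q x"
          using Y_less by auto
        then have "ennreal \<omega> \<le> ennreal r"
          using elim(2) r(1) by (metis less_imp_le order_trans)
        then show "\<omega> \<le> r" using r by simp
      qed (use r in auto)
    qed
  qed
  have "Q = distr (P \<Otimes>\<^sub>M unit_uniform) (N \<Otimes>\<^sub>M borel) (\<lambda>(x, \<omega>). (x, Y (x, \<omega>)))" (is "_ = ?D")
  proof (rule measure_eqI_generator_eq)
    let ?G = "{A \<times> B |A B. A \<in> sets N \<and> B \<in> range (lessThan :: real \<Rightarrow> real set)}"
    show "Int_stable ?G"
    proof (rule Int_stableI)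
      fix a b assume "a \<in> ?G" "b \<in> ?G"
      then obtain A s B t where "a = A \<times> {..<s}" "b = B \<times> {..<t}" "A \<in> sets N" "B \<in> sets N"
        by auto
      moreover have "A \<times> {..<s} \<inter> B \<times> {..<t} = (A \<inter> B) \<times> {..<min s t}" by auto
      ultimately show "a \<inter> b \<in> ?G" by auto
    qed
    show G: "?G \<subseteq> Pow (space N \<times> UNIV)"
      using sets.space_closed by auto
    have "sets (N \<Otimes>\<^sub>M (borel :: real measure)) = sets (sigma (space N \<times> space (borel :: real measure)) ?G)"
    proof (rule sets_pair_eq)
      show "sets (borel :: real measure) = sigma_sets (space borel) (range lessThan)"
        by (subst borel_Iio) (simp add: sets_measure_of)
      show "range (\<lambda>n. {..<real n}) \<subseteq> range lessThan" by auto
      show "\<Union> (range (\<lambda>n. {..<real n})) = space borel" using reals_Archimedean2 by auto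
      show "{space N} \<subseteq> sets N" by auto
    qed (auto simp: sets.space_closed sets.sigma_sets_eq)
    also have "\<dots> = sigma_sets (space N \<times> UNIV) ?G"
      using G by simp
    finally have s: "sets (N \<Otimes>\<^sub>M (borel :: real measure)) = sigma_sets (space N \<times> UNIV) ?G" .
    show "sets Q = sigma_sets (space N \<times> UNIV) ?G" "sets ?D = sigma_sets (space N \<times> UNIV) ?G"
      using s sQ by simp_all
    show "range (\<lambda>n. space N \<times> {..<real n}) \<subseteq> ?G" by auto
    show "(\<Union>n. space N \<times> {..<real n}) = space N \<times> UNIV"
      using reals_Archimedean2 by auto
    show "emeasure Q (space N \<times> {..<real n}) \<noteq> \<infinity>" for n by simp
    fix X assume "X \<in> ?G"
    then obtain A t where X: "X = A \<times> {..<t}" and A [measurable]: "A \<in> sets N" by auto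
    let ?T = "\<lambda>(x, \<omega>). (x, Y (x, \<omega>))"
    have T [measurable]: "?T \<in> P \<Otimes>\<^sub>M unit_uniform \<rightarrow>\<^sub>M N \<Otimes>\<^sub>M borel" by measurable
    have X_meas: "X \<in> sets (N \<Otimes>\<^sub>M borel)" unfolding X by auto
    have "emeasure ?D X = emeasure (P \<Otimes>\<^sub>M unit_uniform) (?T -` X \<inter> space (P \<Otimes>\<^sub>M unit_uniform))"
      by (rule emeasure_distr[OF T X_meas])
    also have "\<dots> = (\<integral>\<^sup>+x. emeasure unit_uniform (Pair x -` (?T -` X \<inter> space (P \<Otimes>\<^sub>M unit_uniform))) \<partial>P)"
      by (rule U.emeasure_pair_measure_alt[OF measurable_sets[OF T X_meas]])
    also have "\<dots> = (\<integral>\<^sup>+x\<in>A. emeasure unit_uniform {\<omega>. Y (x, \<omega>) < t} \<partial>P)"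
    proof (rule nn_integral_cong)
      fix x assume "x \<in> space P"
      then have "Pair x -` (?T -` X \<inter> space (P \<Otimes>\<^sub>M unit_uniform)) = (if x \<in> A then {\<omega>. Y (x, \<omega>) < t} else {})"
        by (auto simp: X space_pair_measure)
      then show "emeasure unit_uniform (Pair x -` (?T -` X \<inter> space (P \<Otimes>\<^sub>M unit_uniform))) =
          emeasure unit_uniform {\<omega>. Y (x, \<omega>) < t} * indicator A x"
        by (simp del: emeasure_uniform_measure)
    qed
    also have "\<dots> = (\<integral>\<^sup>+x\<in>A. F t x \<partial>P)"
      using key[of t] by (intro nn_integral_cong_AE) (auto elim!: eventually_mono)
    finally show "emeasure Q X = emeasure ?D X"
      using F[OF A] X by simp
  qed
  then show ?thesis
    using that[OF Y] unfolding P_def by simp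
qed

text \<open>The second coordinate is coded by a real, parametrized and decoded; \<open>dec\<close>
  undoes \<open>code\<close> everywhere, and the first marginal is not touched.\<close>

lemma pair_parametrization:
  fixes Q :: "('a \<times> 'b::euclidean_space) measure"
  assumes Q: "finite_measure Q" and sQ: "sets Q = sets (N \<Otimes>\<^sub>M borel)"
  obtains Z where "Z \<in> borel_measurable (N \<Otimes>\<^sub>M unit_uniform)"
    "Q = distr (distr Q N fst \<Otimes>\<^sub>M unit_uniform) (N \<Otimes>\<^sub>M borel) (\<lambda>(x, \<omega>). (x, Z (x, \<omega>)))"
proof -
  note [measurable_cong] = sQ
  interpret Q: finite_measure Q by fact
  obtain code :: "'b \<Rightarrow> real" and dec where
    code [measurable]: "code \<in> borel_measurable borel" and cont: "continuous_on UNIV dec"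
    and dec_code: "\<And>y. dec (code y) = y"
    using euclidean_real_coding[where 'a='b] by metis
  have dec [measurable]: "dec \<in> borel_measurable borel"
    using cont by (rule borel_measurable_continuous_onI)
  define R where "R = distr Q (N \<Otimes>\<^sub>M borel) (\<lambda>(x, y). (x, code y))"
  have "finite_measure R"
    unfolding R_def by (rule Q.finite_measure_distr) measurable
  moreover have "sets R = sets (N \<Otimes>\<^sub>M borel)"
    unfolding R_def by simp
  ultimately obtain Y where Y [measurable]: "Y \<in> borel_measurable (N \<Otimes>\<^sub>M unit_uniform)"
    and R: "R = distr (distr R N fst \<Otimes>\<^sub>M unit_uniform) (N \<Otimes>\<^sub>M borel) (\<lambda>(x, \<omega>). (x, Y (x, \<omega>)))"
    by (rule real_pair_parametrization)
  have marginal: "distr R N fst = distr Q N fst"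
    unfolding R_def by (subst distr_distr) (auto intro!: distr_cong)
  have "Q = distr Q (N \<Otimes>\<^sub>M borel) (\<lambda>z. z)"
    by (rule distr_id2[symmetric]) (rule sQ[symmetric])
  also have "\<dots> = distr R (N \<Otimes>\<^sub>M borel) (\<lambda>(x, t). (x, dec t))"
    unfolding R_def by (subst distr_distr) (auto intro!: distr_cong simp: dec_code)
  also have "\<dots> = distr (distr Q N fst \<Otimes>\<^sub>M unit_uniform) (N \<Otimes>\<^sub>M borel) (\<lambda>(x, \<omega>). (x, dec (Y (x, \<omega>))))"
    by (subst R, unfold marginal, subst distr_distr) (auto intro!: distr_cong)
  finally show ?thesis
    using that[of "\<lambda>z. dec (Y z)"] by simp
qed

subsection \<open>Comparison of measures through continuous functions\<close>

text \<open>For an open set the indicator is the limit of \<open>min 1 (n * d)\<close>, with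
  \<open>d\<close> the distance to the complement; outer regularity of \<rho> extends the inequality
  to Borel sets.\<close>

lemma emeasure_le_if_integral_continuous_le:
  fixes \<sigma> \<rho> :: "'a::{second_countable_topology, complete_space} measure"
  assumes fin: "finite_measure \<sigma>" "finite_measure \<rho>"
    and sets [measurable_cong]: "sets \<sigma> = sets borel" "sets \<rho> = sets borel"
    and le: "\<And>g :: 'a \<Rightarrow> real. continuous_on UNIV g \<Longrightarrow> bounded (range g) \<Longrightarrow> (\<And>x. 0 \<le> g x) \<Longrightarrow>
      (LINT x|\<sigma>. g x) \<le> (LINT x|\<rho>. g x)"
    and B: "B \<in> sets borel"
  shows "emeasure \<sigma> B \<le> emeasure \<rho> B"
proof -
  interpret l: finite_measure \<sigma> by fact
  interpret r: finite_measure \<rho> by fact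
  have op: "emeasure \<sigma> U \<le> emeasure \<rho> U" if U: "open U" for U
  proof -
    \<comment> \<open>The distance to the empty set is 0 by convention, so the whole space needs its
      own clause.\<close>
    define g where "g n x = (if U = UNIV then 1 else min 1 (real n * infdist x (- U)))" for n x
    have cont: "continuous_on UNIV (g n)" for n
      unfolding g_def by (cases "U = UNIV") (auto intro!: continuous_intros)
    then have [measurable]: "g n \<in> borel_measurable borel" for n
      by (rule borel_measurable_continuous_onI)
    have [measurable]: "U \<in> sets borel" using U by simp
    have g01: "0 \<le> g n x" "g n x \<le> 1" for n x
      unfolding g_def by (auto simp: infdist_nonneg)
    have bdd: "bounded (range (g n))" for n
      unfolding bounded_iff using g01 by (auto intro!: exI[of _ 1])
    have lim: "(\<lambda>n. g n x) \<longlonglongrightarrow> indicator U x" for x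
    proof (cases "U = UNIV")
      case False
      show ?thesis
      proof (cases "x \<in> U")
        case True
        then have d: "0 < infdist x (- U)"
          using in_closed_iff_infdist_zero[of "- U" x] U False infdist_nonneg[of x "- U"]
          by (auto simp: less_le)
        obtain n0 where n0: "1 < real n0 * infdist x (- U)"
          using reals_Archimedean3[OF d] by auto
        have "g n x = 1" if "n0 \<le> n" for n
        proof -
          have "real n0 * infdist x (- U) \<le> real n * infdist x (- U)"
            using that d by (intro mult_right_mono) auto
          then show ?thesis
            unfolding g_def using n0 False by auto
        qed
        then have "\<forall>\<^sub>F n in sequentially. g n x = 1"
          unfolding eventually_sequentially by blast
        then show ?thesis
          using True by (simp add: tendsto_eventually)
      next
        case False
        then show ?thesis
          unfolding g_def using \<open>U \<noteq> UNIV\<close> by simp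
      qed
    qed (simp add: g_def)
    have conv: "(\<lambda>n. LINT x|M. g n x) \<longlonglongrightarrow> measure M U"
      if "finite_measure M" and [measurable_cong]: "sets M = sets borel" for M
    proof -
      interpret finite_measure M by fact
      have "(\<lambda>n. LINT x|M. g n x) \<longlonglongrightarrow> (LINT x|M. indicator U x)"
        using lim g01 by (intro integral_dominated_convergence[where w="\<lambda>_. 1"]) auto
      then show ?thesis
        using sets_eq_imp_space_eq[OF that(2)] by simp
    qed
    have "measure \<sigma> U \<le> measure \<rho> U"
      using conv[OF fin(1) sets(1)] conv[OF fin(2) sets(2)]
      by (rule LIMSEQ_le) (use le[OF cont bdd g01(1)] in auto)
    then show ?thesis
      by (simp add: l.emeasure_eq_measure r.emeasure_eq_measure)
  qed
  have "emeasure \<sigma> B \<le> (INF U\<in>{U. B \<subseteq> U \<and> open U}. emeasure \<rho> U)"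
  proof (rule INF_greatest)
    fix U assume U: "U \<in> {U. B \<subseteq> U \<and> open U}"
    then have "emeasure \<sigma> B \<le> emeasure \<sigma> U"
      using sets by (intro emeasure_mono) auto
    also have "\<dots> \<le> emeasure \<rho> U" using op U by auto
    finally show "emeasure \<sigma> B \<le> emeasure \<rho> U" .
  qed
  also have "\<dots> = emeasure \<rho> B"
    using outer_regular[OF sets(2) _ B] by simp
  finally show ?thesis .
qed

lemma measure_eq_if_integral_continuous_eq:
  fixes \<sigma> \<rho> :: "'a::{second_countable_topology, complete_space} measure"
  assumes fin: "finite_measure \<sigma>" "finite_measure \<rho>"
    and sets: "sets \<sigma> = sets borel" "sets \<rho> = sets borel"
    and eq: "\<And>g :: 'a \<Rightarrow> real. continuous_on UNIV g \<Longrightarrow> bounded (range g) \<Longrightarrow>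
      (LINT x|\<sigma>. g x) = (LINT x|\<rho>. g x)"
  shows "\<sigma> = \<rho>"
proof (rule measure_eqI)
  fix A assume "A \<in> sets \<sigma>"
  then have "A \<in> sets borel" using sets by simp
  then show "emeasure \<sigma> A = emeasure \<rho> A"
    by (intro antisym emeasure_le_if_integral_continuous_le fin sets) (simp_all add: eq)
qed (simp add: sets)

text \<open>The Radon-Nikodym density of \<sigma> is at most 1 almost everywhere, so 1 minus it is
  the density of the difference. The clause on null sets will keep the difference on the closed set
  that carries \<rho>.\<close>

lemma finite_measure_difference:
  fixes \<sigma> \<rho> :: "'a measure"
  assumes fin: "finite_measure \<sigma>" "finite_measure \<rho>" and sets [measurable_cong]: "sets \<sigma> = sets \<rho>"
    and le: "\<And>A. A \<in> sets \<rho> \<Longrightarrow> emeasure \<sigma> A \<le> emeasure \<rho> A"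
  obtains \<mu> where "finite_measure \<mu>" "sets \<mu> = sets \<rho>" "\<And>A. A \<in> null_sets \<rho> \<Longrightarrow> A \<in> null_sets \<mu>"
    "\<And>g :: 'a \<Rightarrow> real. g \<in> borel_measurable \<rho> \<Longrightarrow> bounded (range g) \<Longrightarrow>
      (LINT x|\<rho>. g x) = (LINT x|\<sigma>. g x) + (LINT x|\<mu>. g x)"
proof -
  interpret l: finite_measure \<sigma> by fact
  interpret r: finite_measure \<rho> by fact
  have "absolutely_continuous \<rho> \<sigma>"
    unfolding absolutely_continuous_def null_sets_def using le sets by fastforce
  then obtain f where f [measurable]: "f \<in> borel_measurable \<rho>" and l: "density \<rho> f = \<sigma>"
    using r.Radon_Nikodym[OF _ sets] by blast
  have "AE x in \<rho>. f x \<le> 1"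
  proof (rule AE_le_of_set_nn_integral_le)
    fix A assume A: "A \<in> sets \<rho>"
    then show "(\<integral>\<^sup>+x\<in>A. f x \<partial>\<rho>) \<le> (\<integral>\<^sup>+x\<in>A. 1 \<partial>\<rho>)"
      using le[OF A] emeasure_density[OF f A] l by simp
  qed auto
  \<comment> \<open>A real-valued version of the density, so that \<open>1 - w x\<close> is a true
    subtraction and both parts can enter Bochner integrals.\<close>
  define w where "w x = enn2real (f x)" for x
  have [measurable]: "w \<in> borel_measurable \<rho>" unfolding w_def by measurable
  have w: "AE x in \<rho>. 0 \<le> w x \<and> w x \<le> 1 \<and> f x = ennreal (w x)"
    using \<open>AE x in \<rho>. f x \<le> 1\<close>
  proof eventually_elim
    case (elim x)
    then show ?case
      unfolding w_def by (cases "f x") (auto simp: top_unique)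
  qed
  have lw: "\<sigma> = density \<rho> w"
    unfolding l[symmetric] using w by (intro density_cong) auto
  show ?thesis
  proof
    show "finite_measure (density \<rho> (\<lambda>x. 1 - w x))"
    proof
      have "emeasure (density \<rho> (\<lambda>x. 1 - w x)) (space \<rho>) \<le> (\<integral>\<^sup>+x. 1 \<partial>\<rho>)"
      proof -
        have "emeasure (density \<rho> (\<lambda>x. 1 - w x)) (space \<rho>) =
            (\<integral>\<^sup>+x. ennreal (1 - w x) * indicator (space \<rho>) x \<partial>\<rho>)"
          by (rule emeasure_density) auto
        also have "\<dots> \<le> (\<integral>\<^sup>+x. 1 \<partial>\<rho>)"
        proof (rule nn_integral_mono_AE)
          show "AE x in \<rho>. ennreal (1 - w x) * indicator (space \<rho>) x \<le> 1"
            using w by eventually_elim (auto split: split_indicator)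
        qed
        finally show ?thesis .
      qed
      then show "emeasure (density \<rho> (\<lambda>x. 1 - w x)) (space (density \<rho> (\<lambda>x. 1 - w x))) \<noteq> \<infinity>"
        by (auto simp: top_unique)
    qed
    show "sets (density \<rho> (\<lambda>x. 1 - w x)) = sets \<rho>" by simp
    show "A \<in> null_sets (density \<rho> (\<lambda>x. 1 - w x))" if "A \<in> null_sets \<rho>" for A
      using absolutely_continuousI_density[of "\<lambda>x. ennreal (1 - w x)" \<rho>] that
      unfolding absolutely_continuous_def by auto
    fix g :: "'a \<Rightarrow> real" assume g [measurable]: "g \<in> borel_measurable \<rho>" and "bounded (range g)"
    then obtain B where B: "\<bar>g x\<bar> \<le> B" for x
      unfolding bounded_iff by auto
    have i1: "integrable \<rho> (\<lambda>x. w x * g x)"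
    proof (rule r.integrable_const_bound[where B=B])
      show "AE x in \<rho>. norm (w x * g x) \<le> B"
        using w
      proof eventually_elim
        case (elim x)
        then have "\<bar>w x\<bar> * \<bar>g x\<bar> \<le> 1 * B" using B by (intro mult_mono) auto
        then show ?case by (simp add: abs_mult)
      qed
    qed measurable
    have i2: "integrable \<rho> g"
      using B by (intro r.integrable_const_bound[where B=B]) auto
    have "(LINT x|\<sigma>. g x) = (LINT x|\<rho>. w x * g x)"
      unfolding lw using w by (subst integral_density) auto
    moreover have "(LINT x|density \<rho> (\<lambda>x. 1 - w x). g x) = (LINT x|\<rho>. (1 - w x) * g x)"
      using w by (subst integral_density) auto
    ultimately show "(LINT x|\<rho>. g x) = (LINT x|\<sigma>. g x) + (LINT x|density \<rho> (\<lambda>x. 1 - w x). g x)"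
      using i1 i2 by (simp add: left_diff_distrib)
  qed
qed

subsection \<open>Young measures\<close>

text \<open>The approximating sequence may depend on \<epsilon>, but its error is uniform in
  \<open>k\<close>. The argument serves twice: for replacing a test function and for truncating an
  integrand.\<close>

lemma tendsto_by_approximation:
  fixes a :: "nat \<Rightarrow> real"
  assumes "\<And>\<epsilon>. 0 < \<epsilon> \<Longrightarrow> \<exists>b l. b \<longlonglongrightarrow> l \<and> (\<forall>k. \<bar>a k - b k\<bar> \<le> \<epsilon>) \<and> \<bar>A - l\<bar> \<le> \<epsilon>"
  shows "a \<longlonglongrightarrow> A"
proof (rule LIMSEQ_I)
  fix r :: real assume "0 < r"
  then obtain b l where b: "b \<longlonglongrightarrow> l" and ab: "\<And>k. \<bar>a k - b k\<bar> \<le> r / 4" and Al: "\<bar>A - l\<bar> \<le> r / 4"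
    using assms[of "r / 4"] by auto
  obtain N where N: "\<And>k. N \<le> k \<Longrightarrow> norm (b k - l) < r / 4"
    using LIMSEQ_D[OF b, of "r / 4"] \<open>0 < r\<close> by auto
  have "norm (a k - A) < r" if "N \<le> k" for k
  proof -
    have "\<bar>b k - l\<bar> < r / 4" using N[OF that] by simp
    then show ?thesis using ab[of k] Al \<open>0 < r\<close> unfolding real_norm_def by linarith
  qed
  then show "\<exists>N. \<forall>k\<ge>N. norm (a k - A) < r" by blast
qed

text \<open>Lebesgue measurable functions are limits almost everywhere of continuous ones. Clamping
  to [-C, C] preserves continuity and the limit and supplies the bound for dominated
  convergence.\<close>

lemma bounded_measurable_continuous_approximation:
  fixes g :: "'a::euclidean_space \<Rightarrow> real"
  assumes S: "S \<in> sets lebesgue" and g: "g \<in> borel_measurable (lebesgue_on S)"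
    and C: "AE x in lebesgue_on S. \<bar>g x\<bar> \<le> C" "0 \<le> C"
  obtains \<phi> where "\<And>n. continuous_on UNIV (\<phi> n)" "\<And>n x. \<bar>\<phi> n x\<bar> \<le> C"
    "AE x in lebesgue_on S. (\<lambda>n. \<phi> n x) \<longlonglongrightarrow> g x"
proof -
  have "(\<lambda>x. if x \<in> S then g x else 0) measurable_on UNIV"
    using borel_measurable_if_I[OF g S] by (intro lebesgue_measurable_imp_measurable_on_real) auto
  then obtain N h where N: "negligible N" and h: "\<And>n. continuous_on UNIV (h n)"
    and lim: "\<And>x. x \<notin> N \<Longrightarrow> (\<lambda>n. h n x) \<longlonglongrightarrow> (if x \<in> S then g x else 0)"
    unfolding measurable_on_def by auto
  have "AE x in lebesgue. x \<notin> N"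
    using N by (intro AE_not_in) (simp add: negligible_iff_null_sets)
  then have "AE x in lebesgue_on S. x \<notin> N"
    using S by (subst AE_restrict_space_iff) auto
  then have conv: "AE x in lebesgue_on S. (\<lambda>n. max (- C) (min C (h n x))) \<longlonglongrightarrow> g x"
    using C(1) AE_space
  proof eventually_elim
    case (elim x)
    then have "(\<lambda>n. h n x) \<longlonglongrightarrow> g x" using lim[of x] by (simp add: space_restrict_space)
    then have "(\<lambda>n. max (- C) (min C (h n x))) \<longlonglongrightarrow> max (- C) (min C (g x))"
      by (intro tendsto_intros)
    moreover have "max (- C) (min C (g x)) = g x" using elim by auto
    ultimately show ?case by simp
  qed
  show ?thesis
  proof (rule that)
    show "continuous_on UNIV (\<lambda>x. max (- C) (min C (h n x)))" for n
      by (intro continuous_intros h)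
    show "\<bar>max (- C) (min C (h n x))\<bar> \<le> C" for n x
      using C(2) by auto
  qed (rule conv)
qed

lemma integrable_mult_bounded:
  fixes v g :: "'a \<Rightarrow> real"
  assumes v: "integrable M v" and g: "g \<in> borel_measurable M" and B: "\<And>z. \<bar>g z\<bar> \<le> B"
  shows "integrable M (\<lambda>z. v z * g z)"
proof (rule Bochner_Integration.integrable_bound[OF integrable_mult_left[OF v, of B]])
  have "\<bar>v z\<bar> * \<bar>g z\<bar> \<le> \<bar>v z\<bar> * \<bar>B\<bar>" for z
    using order_trans[OF B abs_ge_self] by (intro mult_left_mono) auto
  then show "AE z in M. norm (v z * g z) \<le> norm (v z * B)"
    by (simp add: abs_mult)
qed (use v g in measurable)

lemma (in finite_measure) integrable_AE_bound_mult:
  fixes f g :: "'a \<Rightarrow> real"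
  assumes [measurable]: "f \<in> borel_measurable M" "g \<in> borel_measurable M"
    and f: "AE x in M. \<bar>f x\<bar> \<le> B" and g: "AE x in M. \<bar>g x\<bar> \<le> C"
  shows "integrable M (\<lambda>x. f x * g x)"
proof (rule integrable_const_bound[where B="\<bar>B\<bar> * \<bar>C\<bar>"])
  show "AE x in M. norm (f x * g x) \<le> \<bar>B\<bar> * \<bar>C\<bar>"
    using f g
  proof eventually_elim
    case (elim x)
    then have "\<bar>f x\<bar> * \<bar>g x\<bar> \<le> \<bar>B\<bar> * \<bar>C\<bar>"
      by (intro mult_mono) auto
    then show ?case by (simp add: abs_mult)
  qed
qed measurable

text \<open>Weak convergence of laws provides continuous test functions, weak convergence in L1
  demands essentially bounded ones. Replacing \<open>g\<close> by \<phi> changes each integral by at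
  most \<open>B\<close> times the L1 distance of the two, whatever \<open>k\<close>.\<close>

lemma tendsto_integral_extend_test_functions:
  fixes F :: "nat \<Rightarrow> 'a::euclidean_space \<Rightarrow> real"
  assumes S: "S \<in> lmeasurable"
    and [measurable]: "\<And>k. F k \<in> borel_measurable (lebesgue_on S)" "G \<in> borel_measurable (lebesgue_on S)"
    and F: "\<And>k x. \<bar>F k x\<bar> \<le> B" and G: "\<And>x. \<bar>G x\<bar> \<le> B"
    and conv: "\<And>\<phi>. continuous_on UNIV \<phi> \<Longrightarrow> bounded (range \<phi>) \<Longrightarrow>
      (\<lambda>k. LINT x|lebesgue_on S. F k x * \<phi> x) \<longlonglongrightarrow> (LINT x|lebesgue_on S. G x * \<phi> x)"
    and g [measurable]: "g \<in> borel_measurable (lebesgue_on S)" and C: "AE x in lebesgue_on S. \<bar>g x\<bar> \<le> C"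
  shows "(\<lambda>k. LINT x|lebesgue_on S. F k x * g x) \<longlonglongrightarrow> (LINT x|lebesgue_on S. G x * g x)"
proof (rule tendsto_by_approximation)
  let ?L = "lebesgue_on S"
  interpret finite_measure ?L by (rule finite_measure_lebesgue_on[OF S])
  have "0 \<le> B" using G[of undefined] by linarith
  have C': "AE x in ?L. \<bar>g x\<bar> \<le> \<bar>C\<bar>" using C by (auto elim!: eventually_mono)
  obtain \<phi> where \<phi>: "\<And>n. continuous_on UNIV (\<phi> n)" "\<And>n x. \<bar>\<phi> n x\<bar> \<le> \<bar>C\<bar>"
    "AE x in ?L. (\<lambda>n. \<phi> n x) \<longlonglongrightarrow> g x"
    using bounded_measurable_continuous_approximation[OF _ g C'] S by (auto simp: fmeasurable_def)
  have \<phi>_meas: "\<phi> n \<in> borel_measurable ?L" for n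
    using borel_measurable_continuous_onI[OF \<phi>(1)[of n]]
    by (intro measurable_restrict_space1) (simp add: measurable_completion)
  note [measurable] = \<phi>_meas
  have \<phi>_bound: "AE x in ?L. \<bar>\<phi> n x\<bar> \<le> \<bar>C\<bar>" for n using \<phi>(2) by simp
  have diff_bound: "AE x in ?L. norm (g x - \<phi> n x) \<le> 2 * \<bar>C\<bar>" for n
    using C'
  proof eventually_elim
    case (elim x)
    then show ?case using \<phi>(2)[of n x] unfolding real_norm_def by linarith
  qed
  have "(\<lambda>n. LINT x|?L. \<bar>g x - \<phi> n x\<bar>) \<longlonglongrightarrow> (LINT x|?L. 0)"
  proof (rule integral_dominated_convergence[where w="\<lambda>_. 2 * \<bar>C\<bar>"])
    show "AE x in ?L. (\<lambda>n. \<bar>g x - \<phi> n x\<bar>) \<longlonglongrightarrow> 0"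
      using \<phi>(3)
    proof eventually_elim
      case (elim x)
      have "(\<lambda>n. \<bar>g x - \<phi> n x\<bar>) \<longlonglongrightarrow> \<bar>g x - g x\<bar>" by (intro tendsto_intros elim)
      then show ?case by simp
    qed
  qed (use diff_bound in auto)
  then have lim: "(\<lambda>n. LINT x|?L. \<bar>g x - \<phi> n x\<bar>) \<longlonglongrightarrow> 0" by simp
  have close: "\<bar>(LINT x|?L. E x * g x) - (LINT x|?L. E x * \<phi> n x)\<bar> \<le> B * (LINT x|?L. \<bar>g x - \<phi> n x\<bar>)"
    if [measurable]: "E \<in> borel_measurable ?L" and E: "\<And>x. \<bar>E x\<bar> \<le> B" for E n
  proof -
    have E': "AE x in ?L. \<bar>E x\<bar> \<le> B" using E by simp
    note i = integrable_AE_bound_mult[OF that(1) g E' C'] integrable_AE_bound_mult[OF that(1) \<phi>_meas E' \<phi>_bound]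
    have "(LINT x|?L. E x * g x) - (LINT x|?L. E x * \<phi> n x) = (LINT x|?L. E x * g x - E x * \<phi> n x)"
      using i by simp
    also have "\<bar>\<dots>\<bar> \<le> (LINT x|?L. B * \<bar>g x - \<phi> n x\<bar>)"
    proof (rule integral_abs_bound_integral)
      show "integrable ?L (\<lambda>x. E x * g x - E x * \<phi> n x)" using i by simp
      show "integrable ?L (\<lambda>x. B * \<bar>g x - \<phi> n x\<bar>)"
        using diff_bound[of n]
        by (intro integrable_mult_right integrable_const_bound[where B="2 * \<bar>C\<bar>"]) auto
      show "\<bar>E x * g x - E x * \<phi> n x\<bar> \<le> B * \<bar>g x - \<phi> n x\<bar>" for x
        using mult_right_mono[OF E[of x], of "\<bar>g x - \<phi> n x\<bar>"]
        by (simp add: abs_mult flip: right_diff_distrib)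
    qed
    finally show ?thesis by simp
  qed
  fix \<epsilon> :: real assume "0 < \<epsilon>"
  then have "0 < \<epsilon> / (B + 1)" using \<open>0 \<le> B\<close> by simp
  then obtain n where n: "(LINT x|?L. \<bar>g x - \<phi> n x\<bar>) < \<epsilon> / (B + 1)"
    using eventually_happens[OF order_tendstoD(2)[OF lim]] by auto
  have "0 \<le> (LINT x|?L. \<bar>g x - \<phi> n x\<bar>)" by simp
  then have "B * (LINT x|?L. \<bar>g x - \<phi> n x\<bar>) \<le> (B + 1) * (LINT x|?L. \<bar>g x - \<phi> n x\<bar>)"
    by (simp add: distrib_right)
  also have "\<dots> \<le> \<epsilon>" using n \<open>0 \<le> B\<close> by (simp add: pos_less_divide_eq mult.commute less_imp_le)
  finally have small: "B * (LINT x|?L. \<bar>g x - \<phi> n x\<bar>) \<le> \<epsilon>" .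
  have "bounded (range (\<phi> n))" unfolding bounded_iff using \<phi>(2) by auto
  then have "(\<lambda>k. LINT x|?L. F k x * \<phi> n x) \<longlonglongrightarrow> (LINT x|?L. G x * \<phi> n x)"
    by (intro conv \<phi>)
  moreover have "\<bar>(LINT x|?L. F k x * g x) - (LINT x|?L. F k x * \<phi> n x)\<bar> \<le> \<epsilon>" for k
    using close[of "F k" n] F small by fastforce
  moreover have "\<bar>(LINT x|?L. G x * g x) - (LINT x|?L. G x * \<phi> n x)\<bar> \<le> \<epsilon>"
    using close[of G n] G small by fastforce
  ultimately show "\<exists>b l. b \<longlonglongrightarrow> l \<and> (\<forall>k. \<bar>(LINT x|?L. F k x * g x) - b k\<bar> \<le> \<epsilon>) \<and>
      \<bar>(LINT x|?L. G x * g x) - l\<bar> \<le> \<epsilon>"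
    by blast
qed

lemma measurable_lebesgue_on_borel [measurable]: "(\<lambda>x. x) \<in> lebesgue_on S \<rightarrow>\<^sub>M borel"
  by (intro measurable_restrict_space1) (simp add: measurable_completion)

lemma measurable_pair_lebesgue_on:
  assumes Z: "Z \<in> borel_measurable (borel \<Otimes>\<^sub>M M)"
  shows "Z \<in> borel_measurable (lebesgue_on S \<Otimes>\<^sub>M M)"
proof -
  have "(\<lambda>z. (fst z, snd z)) \<in> lebesgue_on S \<Otimes>\<^sub>M M \<rightarrow>\<^sub>M borel \<Otimes>\<^sub>M M"
    by (intro measurable_Pair measurable_compose[OF measurable_fst measurable_lebesgue_on_borel] measurable_snd)
  from measurable_compose[OF this Z] show ?thesis by simp
qed

text \<open>The Young measure at \<open>x\<close> is represented as the law of \<open>Z (x, \<omega>)\<close> with \<open>\<omega>\<close> uniform in the unit interval.\<close>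

definition young_parametrization ::
  "'a::euclidean_space set \<Rightarrow> (nat \<Rightarrow> 'a \<Rightarrow> 'b::euclidean_space) \<Rightarrow> ('a \<times> real \<Rightarrow> 'b) \<Rightarrow> bool" where
  "young_parametrization S u Z \<longleftrightarrow> Z \<in> borel_measurable (borel \<Otimes>\<^sub>M unit_uniform) \<and>
     (\<forall>(f :: 'b \<Rightarrow> real) g C. continuous_on UNIV f \<longrightarrow> bounded (range f) \<longrightarrow>
       g \<in> borel_measurable (lebesgue_on S) \<longrightarrow> (AE x in lebesgue_on S. \<bar>g x\<bar> \<le> C) \<longrightarrow>
       (\<lambda>k. LINT x|lebesgue_on S. f (u k x) * g x) \<longlonglongrightarrow>
         (LINT z|(lebesgue_on S \<Otimes>\<^sub>M unit_uniform). f (Z z) * g (fst z)))"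

text \<open>Weak compactness is applied to the joint laws of \<open>(x, u\<^sub>n x)\<close>, all of which have Lebesgue measure
  on \<open>S\<close> as their first marginal.\<close>

theorem young_parametrization_exists:
  fixes u :: "nat \<Rightarrow> 'a::euclidean_space \<Rightarrow> 'b::euclidean_space" and H :: "'b \<Rightarrow> real"
  assumes S: "S \<in> lmeasurable" "bounded S"
    and u [measurable]: "\<And>n. u n \<in> borel_measurable (lebesgue_on S)"
    and H: "continuous_on UNIV H" "\<And>y. norm y \<le> \<kappa> * H y" "\<And>y. 0 \<le> H y"
    and K: "\<And>n. (\<integral>\<^sup>+x. ennreal (H (u n x)) \<partial>lebesgue_on S) \<le> ennreal K"
  obtains s Z where "strict_mono s" "young_parametrization S (\<lambda>k. u (s k)) Z"
proof -
  let ?L = "lebesgue_on S" and ?U = unit_uniform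
  interpret L: finite_measure ?L by (rule finite_measure_lebesgue_on[OF S(1)])
  interpret U: prob_space ?U by (rule prob_space_unit_uniform)
  have S_meas: "S \<in> sets lebesgue" using S(1) by (simp add: fmeasurable_def)
  have [measurable]: "H \<in> borel_measurable borel"
    using H(1) by (rule borel_measurable_continuous_onI)
  define M where "M n = distr ?L (borel :: ('a \<times> 'b) measure) (\<lambda>x. (x, u n x))" for n
  have T [measurable]: "(\<lambda>x. (x, u n x)) \<in> ?L \<rightarrow>\<^sub>M (borel :: ('a \<times> 'b) measure)" for n
    unfolding borel_prod[symmetric] by measurable
  obtain b where b: "\<And>x. x \<in> S \<Longrightarrow> norm x \<le> b"
    using S(2) unfolding bounded_iff by auto
  have tight: "\<exists>R. \<forall>n. measure (M n) {z. R < norm z} \<le> \<epsilon>" if "0 < \<epsilon>" for \<epsilon>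
  proof -
    \<comment> \<open>Chebyshev level: the set where \<open>H (u n x)\<close> reaches
      \<open>t\<close> has measure at most |K| / t, which is at most \<epsilon>. The 1 keeps
      \<open>t\<close> positive when \<open>K\<close> is 0.\<close>
    define t where "t = (\<bar>K\<bar> + 1) / \<epsilon>"
    have t: "0 < t" "\<bar>K\<bar> \<le> \<epsilon> * t" unfolding t_def using that by (auto simp: field_simps)
    \<comment> \<open>The point x contributes at most |b| to the norm of the pair, so a norm above
      \<open>R\<close> forces \<open>H (u n x)\<close> above \<open>t\<close>.\<close>
    define R where "R = \<bar>b\<bar> + \<bar>\<kappa>\<bar> * t"
    have "measure (M n) {z. R < norm z} \<le> \<epsilon>" for n
    proof -
      let ?E = "{x\<in>space ?L. ennreal t \<le> ennreal (H (u n x))}"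
      have E [measurable]: "?E \<in> sets ?L" by measurable
      have "{z. R < norm z} \<in> sets (borel :: ('a \<times> 'b) measure)" by measurable
      then have "measure (M n) {z. R < norm z} = measure ?L ((\<lambda>x. (x, u n x)) -` {z. R < norm z} \<inter> space ?L)"
        unfolding M_def by (intro measure_distr T)
      also have "\<dots> \<le> measure ?L ?E"
      proof (rule L.finite_measure_mono)
        show "(\<lambda>x. (x, u n x)) -` {z. R < norm z} \<inter> space ?L \<subseteq> ?E"
        proof safe
          fix x assume x: "x \<in> space ?L" "R < norm (x, u n x)"
          have "norm (x, u n x) \<le> norm x + norm (u n x)" by (rule norm_Pair_le)
          moreover have "norm x \<le> \<bar>b\<bar>" using b[of x] x(1) by (auto simp: space_restrict_space)
          moreover have "norm (u n x) \<le> \<bar>\<kappa>\<bar> * H (u n x)"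
            using H(2)[of "u n x"] mult_right_mono[OF abs_ge_self[of \<kappa>] H(3)[of "u n x"]] by linarith
          ultimately have "\<bar>\<kappa>\<bar> * t < \<bar>\<kappa>\<bar> * H (u n x)" using x(2) unfolding R_def by linarith
          then have "t < H (u n x)" by (simp add: mult_less_cancel_left)
          then show "ennreal t \<le> ennreal (H (u n x))" by (intro ennreal_leI) simp
        qed
      qed measurable
      also have "measure ?L ?E \<le> \<epsilon>"
      proof -
        have "t * measure ?L ?E \<le> \<bar>K\<bar>"
        proof -
          have "ennreal (t * measure ?L ?E) = ennreal t * emeasure ?L ?E"
            using t by (simp add: L.emeasure_eq_measure ennreal_mult)
          also have "\<dots> = (\<integral>\<^sup>+x. ennreal t * indicator ?E x \<partial>?L)"
            by (rule nn_integral_cmult_indicator[OF E, symmetric])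
          also have "\<dots> \<le> (\<integral>\<^sup>+x. ennreal (H (u n x)) \<partial>?L)"
            by (intro nn_integral_mono) (auto split: split_indicator)
          also have "\<dots> \<le> ennreal \<bar>K\<bar>"
            by (rule order_trans[OF K ennreal_leI[OF abs_ge_self]])
          finally show ?thesis by simp
        qed
        also have "\<dots> \<le> t * \<epsilon>" using t by (simp add: mult.commute)
        finally show ?thesis using t by simp
      qed
      finally show ?thesis .
    qed
    then show ?thesis by blast
  qed
  have M_fin: "finite_measure (M n)" for n
    unfolding M_def by (rule L.finite_measure_distr[OF T])
  have M_mass: "measure (M n) UNIV \<le> measure ?L (space ?L)" for n
    unfolding M_def by (subst measure_distr) (auto intro: T)
  obtain s Q where s: "strict_mono s" and Q: "finite_measure Q" and sQ [measurable_cong]: "sets Q = sets borel"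
    and weak: "converges_weakly (\<lambda>n. M (s n)) Q"
    by (rule tight_finite_measures_weak_compact[of M, OF M_fin _ M_mass tight]) (simp add: M_def)
  have weak_conv: "(\<lambda>k. LINT x|?L. g (x, u (s k) x)) \<longlonglongrightarrow> (LINT z|Q. g z)"
    if "continuous_on UNIV g" "bounded (range g)" for g :: "'a \<times> 'b \<Rightarrow> real"
  proof -
    have g: "g \<in> borel_measurable borel"
      using that(1) by (rule borel_measurable_continuous_onI)
    have "(\<lambda>k. LINT z|M (s k). g z) \<longlonglongrightarrow> (LINT z|Q. g z)"
      using weak that unfolding converges_weakly_def by blast
    then show ?thesis
      unfolding M_def integral_distr[OF T g] .
  qed
  have sQ' [measurable_cong]: "sets Q = sets (borel \<Otimes>\<^sub>M borel)"
    unfolding borel_prod by (rule sQ)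
  interpret Q: finite_measure Q by fact
  \<comment> \<open>\<open>Q\<close> lives on Borel sets, whereas the test functions on
    \<open>S\<close> are only Lebesgue measurable. The Borel image \<open>?P\<close> of
    \<open>?L\<close> serves the disintegration, \<open>?L\<close> the final integrals.\<close>
  let ?P = "distr ?L borel (\<lambda>x. x)"
  interpret P: finite_measure ?P by (rule L.finite_measure_distr) simp
  \<comment> \<open>For a function of x alone the integrals against the laws do not depend on the
    index, so the weak limit inherits their common marginal.\<close>
  have marginal: "distr Q borel fst = ?P"
  proof (rule measure_eq_if_integral_continuous_eq)
    show "finite_measure (distr Q borel fst)" by (rule Q.finite_measure_distr) measurable
    show "finite_measure ?P" by unfold_locales
    fix \<phi> :: "'a \<Rightarrow> real" assume \<phi>: "continuous_on UNIV \<phi>" "bounded (range \<phi>)"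
    have [measurable]: "\<phi> \<in> borel_measurable borel"
      using \<phi>(1) by (rule borel_measurable_continuous_onI)
    have "(\<lambda>k. LINT x|?L. \<phi> (fst (x, u (s k) x))) \<longlonglongrightarrow> (LINT z|Q. \<phi> (fst z))"
    proof (rule weak_conv)
      show "continuous_on UNIV (\<lambda>z :: 'a \<times> 'b. \<phi> (fst z))"
        by (rule continuous_on_compose2[OF \<phi>(1) continuous_on_fst[OF continuous_on_id]]) auto
      show "bounded (range (\<lambda>z :: 'a \<times> 'b. \<phi> (fst z)))"
        by (rule bounded_subset[OF \<phi>(2)]) auto
    qed
    then show "(LINT x|distr Q borel fst. \<phi> x) = (LINT x|?P. \<phi> x)"
      by (simp add: integral_distr LIMSEQ_const_iff)
  qed simp_all
  obtain Z where Z [measurable]: "Z \<in> borel_measurable (borel \<Otimes>\<^sub>M ?U)"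
    and QZ: "Q = distr (?P \<Otimes>\<^sub>M ?U) (borel \<Otimes>\<^sub>M borel) (\<lambda>(x, \<omega>). (x, Z (x, \<omega>)))"
    by (rule pair_parametrization[OF Q sQ', unfolded marginal])
  have Z' [measurable]: "Z \<in> borel_measurable (?L \<Otimes>\<^sub>M ?U)"
    by (rule measurable_pair_lebesgue_on[OF Z])
  interpret PU: pair_sigma_finite ?P ?U ..
  interpret LU: pair_sigma_finite ?L ?U ..
  interpret PUf: finite_measure "?P \<Otimes>\<^sub>M ?U"
    by (intro finite_measure_pair_measure) unfold_locales
  interpret LUf: finite_measure "?L \<Otimes>\<^sub>M ?U"
    by (intro finite_measure_pair_measure) unfold_locales
  show ?thesis
  proof (rule that[OF s], unfold young_parametrization_def, intro conjI allI impI Z)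
    fix f :: "'b \<Rightarrow> real" and g :: "'a \<Rightarrow> real" and C
    assume f: "continuous_on UNIV f" "bounded (range f)"
      and g [measurable]: "g \<in> borel_measurable ?L" and C: "AE x in ?L. \<bar>g x\<bar> \<le> C"
    have [measurable]: "f \<in> borel_measurable borel"
      using f(1) by (rule borel_measurable_continuous_onI)
    obtain B where B: "\<And>y. \<bar>f y\<bar> \<le> B"
      using f(2) unfolding bounded_iff by auto
    define G where "G x = (LINT \<omega>|?U. f (Z (x, \<omega>)))" for x
    have G_meas [measurable]: "G \<in> borel_measurable borel"
      unfolding G_def by measurable
    have G_bound: "\<bar>G x\<bar> \<le> B" for x
    proof -
      have [measurable]: "(\<lambda>\<omega>. Z (x, \<omega>)) \<in> borel_measurable ?U" by measurable
      have "\<bar>G x\<bar> \<le> (LINT \<omega>|?U. B)"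
        unfolding G_def using B order_trans[OF abs_ge_zero B[of undefined]]
        by (intro integral_abs_bound_integral U.integrable_const_bound[where B=B]) auto
      then show ?thesis by (simp add: U.prob_space)
    qed
    \<comment> \<open>For continuous \<phi> the product of \<open>f\<close> and \<phi> is bounded
      and continuous on pairs, which is what the weak limit \<open>Q\<close> can test;
      \<open>g\<close> then enters by approximation.\<close>
    have "(\<lambda>k. LINT x|?L. f (u (s k) x) * g x) \<longlonglongrightarrow> (LINT x|?L. G x * g x)"
    proof (rule tendsto_integral_extend_test_functions[OF S(1) _ _ _ _ _ g C])
      show "G \<in> borel_measurable ?L"
        by (rule measurable_compose[OF measurable_lebesgue_on_borel G_meas])
      fix \<phi> :: "'a \<Rightarrow> real" assume \<phi>: "continuous_on UNIV \<phi>" "bounded (range \<phi>)"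
      have \<phi>_meas [measurable]: "\<phi> \<in> borel_measurable borel"
        using \<phi>(1) by (rule borel_measurable_continuous_onI)
      obtain D where D: "\<And>x. \<bar>\<phi> x\<bar> \<le> D"
        using \<phi>(2) unfolding bounded_iff by auto
      have bound: "\<bar>f y * \<phi> x\<bar> \<le> B * D" for x y
        unfolding abs_mult using order_trans[OF abs_ge_zero B[of y]] by (intro mult_mono B D) auto
      have "(\<lambda>k. LINT x|?L. f (snd (x, u (s k) x)) * \<phi> (fst (x, u (s k) x))) \<longlonglongrightarrow>
          (LINT z|Q. f (snd z) * \<phi> (fst z))"
      proof (rule weak_conv)
        show "continuous_on UNIV (\<lambda>z. f (snd z) * \<phi> (fst z))"
          by (intro continuous_intros continuous_on_compose2[OF f(1)] continuous_on_compose2[OF \<phi>(1)]) auto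
        show "bounded (range (\<lambda>z. f (snd z) * \<phi> (fst z)))"
          unfolding bounded_iff using bound by auto
      qed
      moreover have "(LINT z|Q. f (snd z) * \<phi> (fst z)) = (LINT z|(?P \<Otimes>\<^sub>M ?U). f (Z z) * \<phi> (fst z))"
        unfolding QZ by (subst integral_distr) (auto simp: case_prod_beta)
      moreover have "\<dots> = (LINT x|?P. LINT \<omega>|?U. f (Z (x, \<omega>)) * \<phi> x)"
        using PU.integral_fst'[OF PUf.integrable_const_bound[where B="B * D" and f="\<lambda>z. f (Z z) * \<phi> (fst z)"]] bound
        by simp
      moreover have "\<dots> = (LINT x|?P. G x * \<phi> x)"
        unfolding G_def by simp
      moreover have "\<dots> = (LINT x|?L. G x * \<phi> x)"
        by (subst integral_distr) auto
      ultimately show "(\<lambda>k. LINT x|?L. f (u (s k) x) * \<phi> x) \<longlonglongrightarrow> (LINT x|?L. G x * \<phi> x)"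
        by simp
    qed (use B G_bound in auto)
    moreover have "(LINT x|?L. G x * g x) = (LINT z|(?L \<Otimes>\<^sub>M ?U). f (Z z) * g (fst z))"
    proof -
      have "AE z in ?L \<Otimes>\<^sub>M ?U. \<bar>g (fst z)\<bar> \<le> C"
      proof (rule LU.AE_pair_measure)
        show "{z \<in> space (?L \<Otimes>\<^sub>M ?U). \<bar>g (fst z)\<bar> \<le> C} \<in> sets (?L \<Otimes>\<^sub>M ?U)" by measurable
        show "AE x in ?L. AE \<omega> in ?U. \<bar>g (fst (x, \<omega>))\<bar> \<le> C"
          using C by eventually_elim simp
      qed
      then have "integrable (?L \<Otimes>\<^sub>M ?U) (\<lambda>z. f (Z z) * g (fst z))"
        using B by (intro LUf.integrable_AE_bound_mult[where B=B and C=C]) auto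
      from LU.integral_fst'[OF this] show ?thesis
        unfolding G_def by simp
    qed
    ultimately show "(\<lambda>k. LINT x|?L. f (u (s k) x) * g x) \<longlonglongrightarrow> (LINT z|(?L \<Otimes>\<^sub>M ?U). f (Z z) * g (fst z))"
      by simp
  qed (rule Z)
qed

section \<open>From bounded to unbounded integrands\<close>

lemma young_parametrization_subseq:
  assumes "young_parametrization S u Z" "strict_mono s"
  shows "young_parametrization S (\<lambda>k. u (s k)) Z"
proof -
  have "(\<lambda>k. LINT x|lebesgue_on S. f (u (s k) x) * g x) \<longlonglongrightarrow>
      (LINT z|(lebesgue_on S \<Otimes>\<^sub>M unit_uniform). f (Z z) * g (fst z))"
    if "continuous_on UNIV f" "bounded (range f)" "g \<in> borel_measurable (lebesgue_on S)"
      "AE x in lebesgue_on S. \<bar>g x\<bar> \<le> C" for f :: "'b \<Rightarrow> real" and g C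
    using LIMSEQ_subseq_LIMSEQ[OF _ assms(2), of "\<lambda>k. LINT x|lebesgue_on S. f (u k x) * g x"] that assms(1)
    unfolding young_parametrization_def o_def by blast
  then show ?thesis
    using assms(1) unfolding young_parametrization_def by blast
qed

text \<open>The truncations \<open>min (H y) (real n)\<close> are bounded and continuous, so their
  weighted integrals converge and the limits stay below \<open>l\<close>; monotone convergence in n
  finishes. A constant \<open>a\<close> yields integrability under the Young measure; the weighted
  integrals of \<open>H (u k x)\<close> themselves, taken as \<open>a\<close>, yield the comparison
  behind the concentration measure.\<close>

lemma young_fatou:
  fixes u :: "nat \<Rightarrow> 'a::euclidean_space \<Rightarrow> 'b::euclidean_space" and H :: "'b \<Rightarrow> real"
  assumes S: "S \<in> lmeasurable" and Y: "young_parametrization S u Z"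
    and u [measurable]: "\<And>n. u n \<in> borel_measurable (lebesgue_on S)"
    and H: "continuous_on UNIV H" "\<And>y. 0 \<le> H y"
    and int: "\<And>k. integrable (lebesgue_on S) (\<lambda>x. H (u k x) * g x)"
    and g [measurable]: "g \<in> borel_measurable (lebesgue_on S)" and g0: "\<And>x. 0 \<le> g x" and gC: "\<And>x. g x \<le> C"
    and le: "\<And>k. (LINT x|lebesgue_on S. H (u k x) * g x) \<le> a k" and a: "a \<longlonglongrightarrow> l"
  shows "integrable (lebesgue_on S \<Otimes>\<^sub>M unit_uniform) (\<lambda>z. H (Z z) * g (fst z))" (is ?int)
    and "(LINT z|(lebesgue_on S \<Otimes>\<^sub>M unit_uniform). H (Z z) * g (fst z)) \<le> l" (is ?le)
proof -
  let ?L = "lebesgue_on S" and ?J = "lebesgue_on S \<Otimes>\<^sub>M unit_uniform"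
  interpret L: finite_measure ?L by (rule finite_measure_lebesgue_on[OF S])
  interpret U: prob_space unit_uniform by (rule prob_space_unit_uniform)
  interpret J: finite_measure ?J by (intro finite_measure_pair_measure) unfold_locales
  have [measurable]: "Z \<in> borel_measurable ?J"
    using Y unfolding young_parametrization_def by (intro measurable_pair_lebesgue_on) blast
  have [measurable]: "H \<in> borel_measurable borel"
    using H(1) by (rule borel_measurable_continuous_onI)
  have g_bound: "AE x in ?L. \<bar>g x\<bar> \<le> C" using g0 gC by simp
  define T where "T n z = min (H (Z z)) (real n) * g (fst z)" for n z
  have T_int: "integrable ?J (T n)" for n
    unfolding T_def using H(2) g0 gC
    by (intro J.integrable_AE_bound_mult[where B="real n" and C=C]) auto
  have T_le: "(LINT z|?J. T n z) \<le> l" for n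
  proof -
    have "(\<lambda>k. LINT x|?L. min (H (u k x)) (real n) * g x) \<longlonglongrightarrow> (LINT z|?J. T n z)"
    proof -
      have "continuous_on UNIV (\<lambda>y. min (H y) (real n))"
        by (intro continuous_intros H)
      moreover have "bounded (range (\<lambda>y. min (H y) (real n)))"
        unfolding bounded_iff using H(2) by (auto intro!: exI[of _ "real n"])
      ultimately show ?thesis
        using Y g g_bound unfolding young_parametrization_def T_def by blast
    qed
    moreover have "(LINT x|?L. min (H (u k x)) (real n) * g x) \<le> a k" for k
    proof (rule order_trans[OF integral_mono le])
      show "integrable ?L (\<lambda>x. min (H (u k x)) (real n) * g x)"
        using H(2) g_bound
        by (intro L.integrable_AE_bound_mult[where B="real n" and C=C]) auto
      show "min (H (u k x)) (real n) * g x \<le> H (u k x) * g x" for x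
        using g0 by (intro mult_right_mono) auto
    qed (rule int)
    ultimately show ?thesis
      using a by (intro LIMSEQ_le[of _ _ a l]) auto
  qed
  have T_nonneg: "0 \<le> T n z" for n z
    unfolding T_def using H(2) g0 by simp
  have "(\<lambda>n. \<integral>\<^sup>+z. ennreal (T n z) \<partial>?J) \<longlonglongrightarrow> (\<integral>\<^sup>+z. ennreal (H (Z z) * g (fst z)) \<partial>?J)"
  proof (rule nn_integral_LIMSEQ)
    have "T m z \<le> T n z" if "m \<le> n" for m n z
      unfolding T_def using that g0 by (intro mult_right_mono) auto
    then show "incseq (\<lambda>n z. ennreal (T n z))"
      by (auto simp: incseq_def le_fun_def intro!: ennreal_leI)
    show "(\<lambda>n. ennreal (T n z)) \<longlonglongrightarrow> ennreal (H (Z z) * g (fst z))" for z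
    proof (rule tendsto_ennrealI, rule tendsto_eventually)
      obtain n0 where "H (Z z) \<le> real n0" using real_arch_simple by blast
      then show "\<forall>\<^sub>F n in sequentially. T n z = H (Z z) * g (fst z)"
        unfolding T_def eventually_sequentially by (auto intro!: exI[of _ n0])
    qed
    show "(\<lambda>z. ennreal (T n z)) \<in> borel_measurable ?J" for n
      unfolding T_def by measurable
  qed
  moreover have "(\<integral>\<^sup>+z. ennreal (T n z) \<partial>?J) \<le> ennreal l" for n
    using T_le[of n] T_nonneg by (subst nn_integral_eq_integral[OF T_int]) (auto intro: ennreal_leI)
  ultimately have nn: "(\<integral>\<^sup>+z. ennreal (H (Z z) * g (fst z)) \<partial>?J) \<le> ennreal l"
    by (intro LIMSEQ_le_const2) auto
  show ?int
  proof (rule integrableI_bounded)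
    show "(\<integral>\<^sup>+z. ennreal (norm (H (Z z) * g (fst z))) \<partial>?J) < \<infinity>"
      using le_less_trans[OF nn ennreal_less_top] H(2) g0 by simp
  qed measurable
  have "0 \<le> l"
    using order_trans[OF integral_nonneg_AE T_le] T_nonneg by blast
  have "ennreal (LINT z|?J. H (Z z) * g (fst z)) \<le> ennreal l"
    using nn nn_integral_eq_integral[OF \<open>?int\<close>] H(2) g0 by simp
  then show ?le using \<open>0 \<le> l\<close> by (simp add: ennreal_le_iff)
qed

text \<open>Truncation at \<open>R\<close> changes \<open>f y\<close> only where its modulus exceeds
  \<open>R\<close>, and there the change is at most \<open>\<epsilon> * H y\<close>. The measure
  space is left abstract because the estimate is applied both to \<open>u k\<close> over
  \<open>S\<close> and to \<open>Z\<close> over the product with the unit interval.\<close>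

lemma (in finite_measure) truncation_error:
  fixes f H :: "'b::euclidean_space \<Rightarrow> real" and v :: "'a \<Rightarrow> 'b"
  assumes [measurable]: "v \<in> borel_measurable M" "f \<in> borel_measurable borel" "g \<in> borel_measurable M"
    and H: "\<And>y. 0 \<le> H y" "integrable M (\<lambda>z. H (v z))" "(LINT z|M. H (v z)) \<le> K"
    and R: "0 \<le> R" "\<And>y. \<bar>f y\<bar> \<le> R \<or> \<bar>f y\<bar> \<le> \<epsilon> * H y" and \<epsilon>: "0 \<le> \<epsilon>"
    and g: "AE z in M. \<bar>g z\<bar> \<le> C" and C: "0 \<le> C"
  shows "integrable M (\<lambda>z. f (v z))" (is ?f)
    and "integrable M (\<lambda>z. f (v z) * g z)" (is ?fg)
    and "\<bar>(LINT z|M. f (v z) * g z) - (LINT z|M. max (- R) (min R (f (v z))) * g z)\<bar> \<le> \<epsilon> * K * C" (is ?err)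
proof -
  have b: "\<bar>f y\<bar> \<le> R + \<epsilon> * H y" for y
    using R(2)[of y] R(1) H(1)[of y] \<epsilon> mult_nonneg_nonneg[OF \<epsilon> H(1)[of y]] by linarith
  have iH: "integrable M (\<lambda>z. R + \<epsilon> * H (v z))"
    using H(2) by simp
  show ?f
    by (rule Bochner_Integration.integrable_bound[OF iH]) (use b in \<open>auto intro: order_trans[OF _ abs_ge_self]\<close>)
  have int: "integrable M (\<lambda>z. F z * g z)"
    if [measurable]: "F \<in> borel_measurable M" and F: "\<And>z. \<bar>F z\<bar> \<le> R + \<epsilon> * H (v z)" for F
  proof (rule Bochner_Integration.integrable_bound[of M "\<lambda>z. (R + \<epsilon> * H (v z)) * C"])
    show "integrable M (\<lambda>z. (R + \<epsilon> * H (v z)) * C)"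
      using iH by (rule integrable_mult_left)
    show "AE z in M. norm (F z * g z) \<le> norm ((R + \<epsilon> * H (v z)) * C)"
      using g
    proof eventually_elim
      case (elim z)
      have "\<bar>F z\<bar> * \<bar>g z\<bar> \<le> \<bar>R + \<epsilon> * H (v z)\<bar> * \<bar>C\<bar>"
        using F[of z] elim by (intro mult_mono) auto
      then show ?case by (simp add: abs_mult)
    qed
  qed measurable
  show fg: ?fg using b by (intro int) auto
  have tb: "\<bar>max (- R) (min R (f (v z)))\<bar> \<le> R + \<epsilon> * H (v z)" for z
    using R(1) b[of "v z"] by linarith
  have tr: "integrable M (\<lambda>z. max (- R) (min R (f (v z))) * g z)"
    using tb by (intro int) auto
  have "\<bar>(LINT z|M. f (v z) * g z) - (LINT z|M. max (- R) (min R (f (v z))) * g z)\<bar> =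
      \<bar>LINT z|M. f (v z) * g z - max (- R) (min R (f (v z))) * g z\<bar>"
    using fg tr by simp
  also have "\<dots> \<le> (LINT z|M. \<bar>f (v z) * g z - max (- R) (min R (f (v z))) * g z\<bar>)"
    by (rule integral_abs_bound)
  also have "\<dots> \<le> (LINT z|M. \<epsilon> * H (v z) * C)"
  proof (rule integral_mono_AE)
    show "integrable M (\<lambda>z. \<bar>f (v z) * g z - max (- R) (min R (f (v z))) * g z\<bar>)"
      using fg tr by simp
    show "integrable M (\<lambda>z. \<epsilon> * H (v z) * C)"
      using H(2) by simp
    show "AE z in M. \<bar>f (v z) * g z - max (- R) (min R (f (v z))) * g z\<bar> \<le> \<epsilon> * H (v z) * C"
      using g
    proof eventually_elim
      case (elim z)
      have "\<bar>f (v z) - max (- R) (min R (f (v z)))\<bar> \<le> \<epsilon> * H (v z)"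
        using R(1) R(2)[of "v z"] mult_nonneg_nonneg[OF \<epsilon> H(1)[of "v z"]] by linarith
      then have "\<bar>f (v z) - max (- R) (min R (f (v z)))\<bar> * \<bar>g z\<bar> \<le> \<epsilon> * H (v z) * C"
        using elim C mult_nonneg_nonneg[OF \<epsilon> H(1)[of "v z"]] by (intro mult_mono) auto
      then show ?case by (simp add: abs_mult flip: left_diff_distrib)
    qed
  qed
  also have "\<dots> = \<epsilon> * (LINT z|M. H (v z)) * C"
    by simp
  also have "\<dots> \<le> \<epsilon> * K * C"
    using H(3) \<epsilon> C by (intro mult_right_mono mult_left_mono) auto
  finally show ?err .
qed

text \<open>By \<open>fH\<close> the integrand grows more slowly than \<open>H\<close>, so the
  functions \<open>f (u k x)\<close> are uniformly integrable: truncation errors are small uniformly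
  in \<open>k\<close>, and the truncated integrand falls under the bounded case.\<close>

lemma young_convergence:
  fixes u :: "nat \<Rightarrow> 'a::euclidean_space \<Rightarrow> 'b::euclidean_space" and f H :: "'b \<Rightarrow> real"
  assumes S: "S \<in> lmeasurable" and Y: "young_parametrization S u Z"
    and u [measurable]: "\<And>n. u n \<in> borel_measurable (lebesgue_on S)"
    and H: "continuous_on UNIV H" "\<And>y. 0 \<le> H y"
    and int: "\<And>k. integrable (lebesgue_on S) (\<lambda>x. H (u k x))" "\<And>k. (LINT x|lebesgue_on S. H (u k x)) \<le> K"
    and f: "continuous_on UNIV f"
    and fH: "\<And>\<epsilon>. 0 < \<epsilon> \<Longrightarrow> \<exists>R\<ge>0. \<forall>y. \<bar>f y\<bar> \<le> R \<or> \<bar>f y\<bar> \<le> \<epsilon> * H y"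
  shows "integrable (lebesgue_on S) (\<lambda>x. f (u k x))"
    and "integrable (lebesgue_on S \<Otimes>\<^sub>M unit_uniform) (\<lambda>z. f (Z z))"
    and "\<lbrakk>g \<in> borel_measurable (lebesgue_on S); AE x in lebesgue_on S. \<bar>g x\<bar> \<le> C\<rbrakk> \<Longrightarrow>
      integrable (lebesgue_on S \<Otimes>\<^sub>M unit_uniform) (\<lambda>z. f (Z z) * g (fst z))"
    and "\<lbrakk>g \<in> borel_measurable (lebesgue_on S); AE x in lebesgue_on S. \<bar>g x\<bar> \<le> C\<rbrakk> \<Longrightarrow>
      (\<lambda>k. LINT x|lebesgue_on S. f (u k x) * g x) \<longlonglongrightarrow>
        (LINT z|(lebesgue_on S \<Otimes>\<^sub>M unit_uniform). f (Z z) * g (fst z))"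
proof -
  let ?L = "lebesgue_on S" and ?J = "lebesgue_on S \<Otimes>\<^sub>M unit_uniform"
  interpret L: finite_measure ?L by (rule finite_measure_lebesgue_on[OF S])
  interpret U: prob_space unit_uniform by (rule prob_space_unit_uniform)
  interpret LU: pair_sigma_finite ?L unit_uniform ..
  interpret J: finite_measure ?J by (intro finite_measure_pair_measure) unfold_locales
  have Zm [measurable]: "Z \<in> borel_measurable ?J"
    using Y unfolding young_parametrization_def by (intro measurable_pair_lebesgue_on) blast
  have fm [measurable]: "f \<in> borel_measurable borel"
    using f by (rule borel_measurable_continuous_onI)
  \<comment> \<open>Fatou with weight 1 and the constant bound \<open>K\<close> gives the Young
    measure the same bound as the sequence, so the truncation estimate applies to both.\<close>
  have "integrable ?J (\<lambda>z. H (Z z) * 1)"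
    by (rule young_fatou(1)[OF S Y u H, where g="\<lambda>_. 1" and C=1 and a="\<lambda>_. K" and l=K]) (use int in simp_all)
  moreover have "(LINT z|?J. H (Z z) * 1) \<le> K"
    by (rule young_fatou(2)[OF S Y u H, where g="\<lambda>_. 1" and C=1 and a="\<lambda>_. K" and l=K]) (use int in simp_all)
  ultimately have HZ: "integrable ?J (\<lambda>z. H (Z z))" "(LINT z|?J. H (Z z)) \<le> K" by simp_all
  have K0: "0 \<le> K"
    using order_trans[OF integral_nonneg_AE int(2)] H(2) by blast
  obtain R1 where R1: "0 \<le> R1" "\<And>y. \<bar>f y\<bar> \<le> R1 \<or> \<bar>f y\<bar> \<le> 1 * H y"
    using fH[of 1] by auto
  show "integrable ?L (\<lambda>x. f (u k x))"
    by (rule L.truncation_error(1)[OF u fm _ H(2) int(1) int(2) R1, where g="\<lambda>_. 0" and C=0]) auto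
  show fZ: "integrable ?J (\<lambda>z. f (Z z))"
    by (rule J.truncation_error(1)[OF Zm fm _ H(2) HZ R1, where g="\<lambda>_. 0" and C=0]) auto
  assume g [measurable]: "g \<in> borel_measurable ?L" and "AE x in ?L. \<bar>g x\<bar> \<le> C"
  then have C: "AE x in ?L. \<bar>g x\<bar> \<le> \<bar>C\<bar>" by (auto elim!: eventually_mono)
  have CJ: "AE z in ?J. \<bar>g (fst z)\<bar> \<le> \<bar>C\<bar>"
  proof (rule LU.AE_pair_measure)
    show "{z \<in> space ?J. \<bar>g (fst z)\<bar> \<le> \<bar>C\<bar>} \<in> sets ?J" by measurable
    show "AE x in ?L. AE \<omega> in unit_uniform. \<bar>g (fst (x, \<omega>))\<bar> \<le> \<bar>C\<bar>"
      using C by eventually_elim simp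
  qed
  have gJ [measurable]: "(\<lambda>z. g (fst z)) \<in> borel_measurable ?J" by measurable
  show "integrable ?J (\<lambda>z. f (Z z) * g (fst z))"
    by (rule J.truncation_error(2)[OF Zm fm gJ H(2) HZ R1 _ CJ]) auto
  show "(\<lambda>k. LINT x|?L. f (u k x) * g x) \<longlonglongrightarrow> (LINT z|?J. f (Z z) * g (fst z))"
  proof (rule tendsto_by_approximation)
    fix \<epsilon> :: real assume "0 < \<epsilon>"
    \<comment> \<open>Chosen so that the truncation error
      \<open>\<delta> * K * \<bar>C\<bar>\<close> is at most \<epsilon>; the 1 covers a vanishing
      product \<open>K * \<bar>C\<bar>\<close>.\<close>
    define \<delta> where "\<delta> = \<epsilon> / (K * \<bar>C\<bar> + 1)"
    have pos: "0 < K * \<bar>C\<bar> + 1" using K0 by (simp add: add_nonneg_pos)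
    then have \<delta>: "0 < \<delta>" unfolding \<delta>_def using \<open>0 < \<epsilon>\<close> by simp
    have "\<delta> * (K * \<bar>C\<bar>) \<le> \<delta> * (K * \<bar>C\<bar> + 1)" using \<delta> by simp
    also have "\<dots> = \<epsilon>" unfolding \<delta>_def using pos by simp
    finally have small: "\<delta> * K * \<bar>C\<bar> \<le> \<epsilon>" by (simp add: mult.assoc)
    obtain R where R: "0 \<le> R" "\<And>y. \<bar>f y\<bar> \<le> R \<or> \<bar>f y\<bar> \<le> \<delta> * H y"
      using fH[OF \<delta>] by auto
    have "continuous_on UNIV (\<lambda>y. max (- R) (min R (f y)))"
      by (intro continuous_intros f)
    moreover have "bounded (range (\<lambda>y. max (- R) (min R (f y))))"
      unfolding bounded_iff using R(1) by (auto intro!: exI[of _ R])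
    ultimately have "(\<lambda>k. LINT x|?L. max (- R) (min R (f (u k x))) * g x) \<longlonglongrightarrow>
        (LINT z|?J. max (- R) (min R (f (Z z))) * g (fst z))"
      using Y g C unfolding young_parametrization_def by blast
    moreover have "\<bar>(LINT x|?L. f (u k x) * g x) - (LINT x|?L. max (- R) (min R (f (u k x))) * g x)\<bar> \<le> \<epsilon>" for k
      by (rule order_trans[OF L.truncation_error(3)[OF u fm g H(2) int R _ C] small]) (use \<delta> in auto)
    moreover have "\<bar>(LINT z|?J. f (Z z) * g (fst z)) - (LINT z|?J. max (- R) (min R (f (Z z))) * g (fst z))\<bar> \<le> \<epsilon>"
      by (rule order_trans[OF J.truncation_error(3)[OF Zm fm gJ H(2) HZ R _ CJ] small]) (use \<delta> in auto)
    ultimately show "\<exists>b l. b \<longlonglongrightarrow> l \<and> (\<forall>k. \<bar>(LINT x|?L. f (u k x) * g x) - b k\<bar> \<le> \<epsilon>) \<and>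
        \<bar>(LINT z|?J. f (Z z) * g (fst z)) - l\<bar> \<le> \<epsilon>"
      by blast
  qed
qed

subsection \<open>Concentration\<close>

text \<open>The measure is first produced on the whole space, where weak compactness is available,
  together with the information that the closure carries it. The extraction is a further one, under
  which \<open>Z\<close> stays valid.\<close>

lemma concentration_measure_exists:
  fixes u :: "nat \<Rightarrow> 'a::euclidean_space \<Rightarrow> 'b::euclidean_space" and H :: "'b \<Rightarrow> real"
  assumes S: "S \<in> lmeasurable" "bounded S" and Y: "young_parametrization S u Z"
    and u [measurable]: "\<And>n. u n \<in> borel_measurable (lebesgue_on S)"
    and H: "continuous_on UNIV H" "\<And>y. 0 \<le> H y"
    and int: "\<And>k. integrable (lebesgue_on S) (\<lambda>x. H (u k x))" "\<And>k. (LINT x|lebesgue_on S. H (u k x)) \<le> K"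
  shows "\<exists>s \<mu>. strict_mono s \<and> finite_measure \<mu> \<and> sets \<mu> = sets borel \<and> (AE x in \<mu>. x \<in> closure S) \<and>
    (\<forall>\<phi> :: 'a \<Rightarrow> real. continuous_on UNIV \<phi> \<longrightarrow> bounded (range \<phi>) \<longrightarrow>
      (\<lambda>k. LINT x|lebesgue_on S. H (u (s k) x) * \<phi> x) \<longlonglongrightarrow>
        (LINT z|(lebesgue_on S \<Otimes>\<^sub>M unit_uniform). H (Z z) * \<phi> (fst z)) + (LINT x|\<mu>. \<phi> x))"
proof -
  let ?L = "lebesgue_on S" and ?J = "lebesgue_on S \<Otimes>\<^sub>M unit_uniform"
  interpret L: finite_measure ?L by (rule finite_measure_lebesgue_on[OF S(1)])
  interpret U: prob_space unit_uniform by (rule prob_space_unit_uniform)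
  interpret J: finite_measure ?J by (intro finite_measure_pair_measure) unfold_locales
  have Zm [measurable]: "Z \<in> borel_measurable ?J"
    using Y unfolding young_parametrization_def by (intro measurable_pair_lebesgue_on) blast
  have Hm [measurable]: "H \<in> borel_measurable borel"
    using H(1) by (rule borel_measurable_continuous_onI)
  have "integrable ?J (\<lambda>z. H (Z z) * 1)"
    by (rule young_fatou(1)[OF S(1) Y u H, where g="\<lambda>_. 1" and C=1 and a="\<lambda>_. K" and l=K]) (use int in simp_all)
  then have HZ: "integrable ?J (\<lambda>z. H (Z z))" by simp
  define N where "N n = distr (density ?L (\<lambda>x. ennreal (H (u n x)))) borel (\<lambda>x. x)" for n
  have N_emeasure: "emeasure (N n) A = (\<integral>\<^sup>+x\<in>A \<inter> S. ennreal (H (u n x)) \<partial>?L)"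
    if [measurable]: "A \<in> sets borel" for n A
  proof -
    have A: "A \<inter> S \<in> sets ?L"
      using measurable_sets[OF measurable_lebesgue_on_borel[of S] that] by (simp add: space_restrict_space)
    have "emeasure (N n) A = emeasure (density ?L (\<lambda>x. ennreal (H (u n x)))) (A \<inter> S)"
      unfolding N_def using that by (subst emeasure_distr) (auto simp: space_restrict_space)
    then show ?thesis using A by (simp add: emeasure_density)
  qed
  have N_UNIV: "emeasure (N n) UNIV \<le> ennreal K" for n
  proof -
    have "emeasure (N n) UNIV = (\<integral>\<^sup>+x. ennreal (H (u n x)) \<partial>?L)"
      by (subst N_emeasure) (auto intro!: nn_integral_cong simp: space_restrict_space)
    also have "\<dots> \<le> ennreal K"
      using int H(2) by (subst nn_integral_eq_integral) (auto intro: ennreal_leI)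
    finally show ?thesis .
  qed
  have N_fin: "finite_measure (N n)" for n
    by (rule finite_measureI) (use N_UNIV[of n] in \<open>auto simp: N_def top_unique\<close>)
  have N_mass: "measure (N n) UNIV \<le> \<bar>K\<bar>" for n
    unfolding measure_def using N_UNIV[of n] by (intro enn2real_leI) (auto intro: order_trans ennreal_leI)
  have N_sets: "sets (N n) = sets borel" for n unfolding N_def by simp
  obtain b where b: "\<And>x. x \<in> S \<Longrightarrow> norm x \<le> b"
    using S(2) unfolding bounded_iff by auto
  \<comment> \<open>All these measures are carried by the bounded set \<open>S\<close>, so none has
    mass outside one fixed ball.\<close>
  have N_tight: "\<exists>R. \<forall>n. measure (N n) {x. R < norm x} \<le> \<epsilon>" if "0 < \<epsilon>" for \<epsilon>
  proof -
    have "emeasure (N n) {x. b < norm x} = 0" for n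
    proof -
      have "{x. b < norm x} \<inter> S = {}" using b by force
      then show ?thesis by (subst N_emeasure) auto
    qed
    then show ?thesis
      using that by (intro exI[of _ b]) (simp add: measure_def)
  qed
  obtain s \<rho> where s: "strict_mono s" and \<rho>: "finite_measure \<rho>" and s\<rho> [measurable_cong]: "sets \<rho> = sets borel"
    and weak: "converges_weakly (\<lambda>n. N (s n)) \<rho>"
    by (rule tight_finite_measures_weak_compact[of N, OF N_fin N_sets N_mass N_tight])
  interpret \<rho>: finite_measure \<rho> by fact
  have \<rho>_meas: "\<phi> \<in> borel_measurable \<rho>" if "\<phi> \<in> borel_measurable borel" for \<phi> :: "'a \<Rightarrow> real"
    by (subst measurable_cong_sets[OF s\<rho> refl]) (rule that)
  have conv: "(\<lambda>k. LINT x|?L. H (u (s k) x) * \<phi> x) \<longlonglongrightarrow> (LINT x|\<rho>. \<phi> x)"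
    if \<phi>: "continuous_on UNIV \<phi>" "bounded (range \<phi>)" for \<phi> :: "'a \<Rightarrow> real"
  proof -
    have \<phi>m [measurable]: "\<phi> \<in> borel_measurable borel"
      using \<phi>(1) by (rule borel_measurable_continuous_onI)
    have [measurable]: "\<phi> \<in> borel_measurable ?L"
      by (rule measurable_compose[OF measurable_lebesgue_on_borel \<phi>m])
    have eq: "(LINT x|N n. \<phi> x) = (LINT x|?L. H (u n x) * \<phi> x)" for n
      unfolding N_def using H(2)
      by (subst integral_distr) (auto simp: integral_density)
    have "(\<lambda>k. LINT x|N (s k). \<phi> x) \<longlonglongrightarrow> (LINT x|\<rho>. \<phi> x)"
      using weak \<phi> unfolding converges_weakly_def by blast
    then show ?thesis unfolding eq .
  qed
  have \<rho>_closure: "AE x in \<rho>. x \<in> closure S"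
  proof -
    \<comment> \<open>For nonempty \<open>S\<close> this vanishes exactly on the closure; its
      integrals along the sequence are 0, hence so is their limit. For empty \<open>S\<close> the
      distance is 0 by convention and would detect nothing, so the constant 1 takes its
      place.\<close>
    define g where "g x = (if S = {} then 1 else min 1 (infdist x (closure S)))" for x
    have g: "continuous_on UNIV g"
      unfolding g_def by (cases "S = {}") (auto intro!: continuous_intros)
    have gm: "g \<in> borel_measurable borel"
      using g by (rule borel_measurable_continuous_onI)
    have g0: "0 \<le> g x" "g x \<le> 1" for x
      unfolding g_def by (auto simp: infdist_nonneg)
    have g_bdd: "bounded (range g)"
      unfolding bounded_iff using g0 by (auto intro!: exI[of _ 1])
    have "(LINT x|?L. H (u (s k) x) * g x) = (LINT x|?L. 0)" for k
      using closure_subset[of S]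
      by (intro Bochner_Integration.integral_cong) (auto simp: g_def space_restrict_space)
    then have "(\<lambda>k. 0) \<longlonglongrightarrow> (LINT x|\<rho>. g x)"
      using conv[OF g g_bdd] by simp
    then have "(LINT x|\<rho>. g x) = 0"
      by (simp add: LIMSEQ_const_iff)
    moreover have "integrable \<rho> g"
      by (rule \<rho>.integrable_bounded_range[OF \<rho>_meas[OF gm] g_bdd])
    ultimately have "AE x in \<rho>. g x = 0"
      using g0 by (subst (asm) integral_nonneg_eq_0_iff_AE) auto
    then show ?thesis
    proof eventually_elim
      case (elim x)
      then have "S \<noteq> {}" "infdist x (closure S) = 0"
        unfolding g_def by (auto split: if_splits simp: min_def)
      then show ?case
        using in_closed_iff_infdist_zero[of "closure S" x] by simp
    qed
  qed
  \<comment> \<open>This is \<open>(\<integral> H d\<nu>\<^sub>x) dx\<close>, written as an image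
    under the first projection so that the inner integral need not be formed.\<close>
  define \<sigma> where "\<sigma> = distr (density ?J (\<lambda>z. ennreal (H (Z z)))) borel fst"
  have fst_meas [measurable]: "fst \<in> borel_measurable ?J"
    by (rule measurable_compose[OF measurable_fst measurable_lebesgue_on_borel])
  have \<sigma>_fin: "finite_measure \<sigma>"
  proof (rule finite_measureI)
    have "emeasure \<sigma> UNIV = (\<integral>\<^sup>+z. ennreal (H (Z z)) \<partial>?J)"
    proof -
      have "emeasure \<sigma> UNIV = emeasure (density ?J (\<lambda>z. ennreal (H (Z z)))) (space ?J)"
        unfolding \<sigma>_def by (subst emeasure_distr) auto
      also have "\<dots> = (\<integral>\<^sup>+z. ennreal (H (Z z)) * indicator (space ?J) z \<partial>?J)"
        by (rule emeasure_density[OF _ sets.top]) measurable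
      also have "\<dots> = (\<integral>\<^sup>+z. ennreal (H (Z z)) \<partial>?J)"
        by (intro nn_integral_cong) auto
      finally show ?thesis .
    qed
    then show "emeasure \<sigma> (space \<sigma>) \<noteq> \<infinity>"
      using nn_integral_eq_integral[OF HZ] H(2) by (simp add: \<sigma>_def)
  qed
  have \<sigma>_sets: "sets \<sigma> = sets borel" unfolding \<sigma>_def by simp
  have \<sigma>_int: "(LINT x|\<sigma>. \<phi> x) = (LINT z|?J. H (Z z) * \<phi> (fst z))"
    if [measurable]: "\<phi> \<in> borel_measurable borel" for \<phi> :: "'a \<Rightarrow> real"
  proof -
    have "(\<lambda>z. \<phi> (fst z)) \<in> borel_measurable ?J"
      by (rule measurable_compose[OF fst_meas that])
    then show ?thesis
      unfolding \<sigma>_def using H(2) by (subst integral_distr) (auto simp: integral_density)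
  qed
  have le: "emeasure \<sigma> A \<le> emeasure \<rho> A" if "A \<in> sets \<rho>" for A
  proof (rule emeasure_le_if_integral_continuous_le[OF \<sigma>_fin \<rho> \<sigma>_sets s\<rho>])
    show "A \<in> sets borel" using that s\<rho> by simp
    fix \<phi> :: "'a \<Rightarrow> real"
    assume \<phi>: "continuous_on UNIV \<phi>" "bounded (range \<phi>)" "\<And>x. 0 \<le> \<phi> x"
    have \<phi>m [measurable]: "\<phi> \<in> borel_measurable borel"
      using \<phi>(1) by (rule borel_measurable_continuous_onI)
    have \<phi>L [measurable]: "\<phi> \<in> borel_measurable ?L"
      by (rule measurable_compose[OF measurable_lebesgue_on_borel \<phi>m])
    obtain C where C: "\<And>x. \<bar>\<phi> x\<bar> \<le> C" using \<phi>(2) unfolding bounded_iff by auto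
    \<comment> \<open>Fatou with weight \<phi> and the sequence of integrals itself as upper bound;
      its limit is the integral against \<rho>.\<close>
    have "(LINT z|?J. H (Z z) * \<phi> (fst z)) \<le> (LINT x|\<rho>. \<phi> x)"
    proof (rule young_fatou(2)[OF S(1) young_parametrization_subseq[OF Y s] u H _ \<phi>L \<phi>(3) _ order_refl conv[OF \<phi>(1,2)]])
      show "integrable ?L (\<lambda>x. H (u (s k) x) * \<phi> x)" for k
        by (rule integrable_mult_bounded[OF int(1) \<phi>L C])
      show "\<phi> x \<le> C" for x using C[of x] by linarith
    qed
    then show "(LINT x|\<sigma>. \<phi> x) \<le> (LINT x|\<rho>. \<phi> x)"
      by (simp add: \<sigma>_int)
  qed
  obtain \<mu> where \<mu>: "finite_measure \<mu>" and s\<mu>: "sets \<mu> = sets \<rho>"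
    and null: "\<And>A. A \<in> null_sets \<rho> \<Longrightarrow> A \<in> null_sets \<mu>"
    and split: "\<And>g :: 'a \<Rightarrow> real. g \<in> borel_measurable \<rho> \<Longrightarrow> bounded (range g) \<Longrightarrow>
      (LINT x|\<rho>. g x) = (LINT x|\<sigma>. g x) + (LINT x|\<mu>. g x)"
    using finite_measure_difference[OF \<sigma>_fin \<rho> _ le] \<sigma>_sets s\<rho> by metis
  have "AE x in \<mu>. x \<in> closure S"
    using \<rho>_closure null sets_eq_imp_space_eq[OF s\<mu>] unfolding eventually_ae_filter by auto
  moreover have "(\<lambda>k. LINT x|?L. H (u (s k) x) * \<phi> x) \<longlonglongrightarrow>
      (LINT z|?J. H (Z z) * \<phi> (fst z)) + (LINT x|\<mu>. \<phi> x)"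
    if \<phi>: "continuous_on UNIV \<phi>" "bounded (range \<phi>)" for \<phi> :: "'a \<Rightarrow> real"
  proof -
    have \<phi>m [measurable]: "\<phi> \<in> borel_measurable borel"
      using \<phi>(1) by (rule borel_measurable_continuous_onI)
    then have "\<phi> \<in> borel_measurable \<rho>" by (rule \<rho>_meas)
    from split[OF this \<phi>(2)] show ?thesis
      using conv[OF \<phi>] by (simp add: \<sigma>_int[OF \<phi>m])
  qed
  ultimately show ?thesis
    using s \<mu> s\<mu> s\<rho> by auto
qed

section \<open>Growth conditions and the theorem for convex integrands\<close>

lemma norm_le_one_plus_powr:
  fixes y :: "'a::real_normed_vector"
  assumes "1 \<le> p"
  shows "norm y \<le> 1 + norm y powr p"
proof (cases "norm y \<le> 1")
  case False
  then have "norm y powr 1 \<le> norm y powr p"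
    using assms by (intro powr_mono) auto
  then show ?thesis using False by simp
qed (simp add: add_increasing2)

text \<open>Off a large ball the quotient is below \<epsilon> / \<kappa> and \<open>w\<close> is at
  most \<kappa> times \<open>H\<close>; on the ball \<open>f\<close> is bounded by compactness. This
  turns the growth condition into the one used for truncation.\<close>

lemma vanishing_ratio_imp_dominated:
  fixes f w H :: "'b::euclidean_space \<Rightarrow> real"
  assumes f: "continuous_on UNIV f" and lim: "((\<lambda>y. \<bar>f y\<bar> / w y) \<longlongrightarrow> 0) at_infinity"
    and w: "\<And>y. 0 < w y" "\<And>y. w y \<le> \<kappa> * H y" and \<kappa>: "0 < \<kappa>" and \<epsilon>: "0 < \<epsilon>"
  shows "\<exists>R\<ge>0. \<forall>y. \<bar>f y\<bar> \<le> R \<or> \<bar>f y\<bar> \<le> \<epsilon> * H y"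
proof -
  have "\<forall>\<^sub>F y in at_infinity. \<bar>f y\<bar> / w y < \<epsilon> / \<kappa>"
    using order_tendstoD(2)[OF lim] \<epsilon> \<kappa> by simp
  then obtain b where b: "\<And>y. b \<le> norm y \<Longrightarrow> \<bar>f y\<bar> / w y < \<epsilon> / \<kappa>"
    unfolding eventually_at_infinity by auto
  have "bounded (f ` cball 0 b)"
    by (intro compact_imp_bounded compact_continuous_image continuous_on_subset[OF f]) auto
  then obtain R where "\<forall>z\<in>f ` cball 0 b. norm z \<le> R"
    unfolding bounded_iff by blast
  then have R: "\<bar>f y\<bar> \<le> R" if "norm y \<le> b" for y
    using that by simp
  have "\<bar>f y\<bar> \<le> \<bar>R\<bar> \<or> \<bar>f y\<bar> \<le> \<epsilon> * H y" for y
  proof (cases "norm y \<le> b")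
    case False
    then have "\<bar>f y\<bar> \<le> \<epsilon> / \<kappa> * w y"
      using b[of y] w(1)[of y] by (simp add: pos_divide_less_eq)
    also have "\<dots> \<le> \<epsilon> / \<kappa> * (\<kappa> * H y)"
      using w(2) \<epsilon> \<kappa> by (intro mult_left_mono) auto
    finally show ?thesis using \<kappa> by simp
  qed (use R[of y] in auto)
  then show ?thesis by (intro exI[of _ "\<bar>R\<bar>"]) auto
qed

text \<open>The negative part of \<open>f\<close> has integral at most \<open>b\<close> times the
  total mass, so it is finite and can be moved to the right-hand side. The absolute value allows for
  a negative \<open>C\<close>.\<close>

lemma nn_integral_le_of_extended_integral_le:
  assumes M: "finite_measure M" and f [measurable]: "f \<in> borel_measurable M"
    and b: "\<And>x. - b \<le> f x" "0 \<le> b" and le: "extended_integral M f \<le> ereal C"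
  shows "(\<integral>\<^sup>+x. ennreal (f x) \<partial>M) \<le> ennreal (\<bar>C\<bar> + b * measure M (space M))"
proof -
  interpret finite_measure M by fact
  define P N where "P = (\<integral>\<^sup>+x. ennreal (f x) \<partial>M)" and "N = (\<integral>\<^sup>+x. ennreal (- f x) \<partial>M)"
  have "N \<le> (\<integral>\<^sup>+x. ennreal b \<partial>M)"
    unfolding N_def using b by (intro nn_integral_mono ennreal_leI) (simp add: minus_le_iff)
  also have "\<dots> = ennreal (b * measure M (space M))"
    using b(2) by (simp add: emeasure_eq_measure ennreal_mult)
  finally have N: "N \<le> ennreal (b * measure M (space M))" .
  then obtain n where n: "N = ennreal n" "0 \<le> n"
    by (cases N) (auto simp: top_unique)
  with N have nb: "n \<le> b * measure M (space M)"
    using b(2) by (subst (asm) n(1)) (simp add: ennreal_le_iff)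
  have "enn2ereal P - enn2ereal N \<le> ereal C"
    using le unfolding extended_integral_def P_def N_def .
  then have "enn2ereal P \<le> ereal (C + n)"
    using n by (cases "enn2ereal P") auto
  then obtain q where q: "P = ennreal q" "0 \<le> q" "q \<le> C + n"
    by (cases P) auto
  show ?thesis
    unfolding P_def[symmetric] q(1) using q nb by (intro ennreal_leI) linarith
qed

text \<open>Bochner integrals of non-integrable functions are 0, so the formulas have their intended
  content only together with the accompanying integrability assertions; these come from Fubini on
  the product with the unit interval.\<close>

theorem theorem2p1:
  fixes \<Omega> :: "(real ^ 'd) set"
    and h :: "real ^ 'm \<Rightarrow> real"
    and u :: "nat \<Rightarrow> real ^ 'd \<Rightarrow> real ^ 'm"
    and p c C :: real
  assumes "open \<Omega>" and "bounded \<Omega>"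
    and "p \<ge> 1"
    and "convex_on UNIV h"
    and "c > 0"
    and "\<And>l. h l \<ge> 1 / c * norm l powr p - c"
    and "\<And>n. u n \<in> borel_measurable (lebesgue_on \<Omega>)"
    and "(SUP n. extended_integral (lebesgue_on \<Omega>) (\<lambda>x. h (u n x))) \<le> ereal C"
  shows "\<exists>(s :: nat \<Rightarrow> nat) (\<nu> :: real ^ 'd \<Rightarrow> (real ^ 'm) measure) (\<mu> :: (real ^ 'd) measure).
    strict_mono s \<and> young_measure \<Omega> \<nu> \<and> concentration_measure_on (closure \<Omega>) \<mu> \<and>
    (\<forall>f :: real ^ 'm \<Rightarrow> real.
       continuous_on UNIV f \<longrightarrow>
       ((\<lambda>l. \<bar>f l\<bar> / (1 + norm l powr p)) \<longlongrightarrow> 0) at_infinity \<longrightarrow>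
       (AE x in lebesgue_on \<Omega>. integrable (\<nu> x) f) \<and>
       weakly_convergent_L1 (lebesgue_on \<Omega>)
         (\<lambda>k x. f (u (s k) x)) (\<lambda>x. LINT l|\<nu> x. f l)) \<and>
    (AE x in lebesgue_on \<Omega>. integrable (\<nu> x) h) \<and>
    integrable (lebesgue_on \<Omega>) (\<lambda>x. LINT l|\<nu> x. h l) \<and>
    (\<forall>\<phi> :: real ^ 'd \<Rightarrow> real.
       continuous_on (closure \<Omega>) \<phi> \<longrightarrow>
       (\<lambda>k. LINT x|lebesgue_on \<Omega>. h (u (s k) x) * \<phi> x) \<longlonglongrightarrow>
         (LINT x|lebesgue_on \<Omega>. (LINT l|\<nu> x. h l) * \<phi> x) + (LINT x|\<mu>. \<phi> x))"
proof -
  note p = \<open>p \<ge> 1\<close> and c = \<open>c > 0\<close> and h_ge = assms(6) and u [measurable] = assms(7)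
  let ?L = "lebesgue_on \<Omega>" and ?U = unit_uniform
  have \<Omega>: "\<Omega> \<in> lmeasurable"
    using assms(1,2) by (rule lmeasurable_open[rotated])
  interpret L: finite_measure ?L by (rule finite_measure_lebesgue_on[OF \<Omega>])
  interpret U: prob_space ?U by (rule prob_space_unit_uniform)
  interpret LU: pair_sigma_finite ?L ?U ..
  interpret J: finite_measure "?L \<Otimes>\<^sub>M ?U" by (intro finite_measure_pair_measure) unfold_locales
  \<comment> \<open>A finite convex function on a finite-dimensional space is continuous, so
    truncations of the shifted \<open>h\<close> are admissible in the weak limits.\<close>
  have h_cont: "continuous_on UNIV h"
    using assms(4) by (intro convex_on_continuous) auto
  have h_meas [measurable]: "h \<in> borel_measurable borel"
    using h_cont by (rule borel_measurable_continuous_onI)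
  \<comment> \<open>The growth condition puts \<open>H l\<close> above 1 + |l|^p / c. So
    \<open>H\<close> is positive and can serve as a density, and (1 + c) * H dominates both 1 +
    |l|^p and the norm.\<close>
  define H where "H l = h l + (1 + c)" for l
  have H_cont: "continuous_on UNIV H"
    unfolding H_def by (intro continuous_intros h_cont)
  have H_meas [measurable]: "H \<in> borel_measurable borel"
    using H_cont by (rule borel_measurable_continuous_onI)
  have powr_nonneg: "0 \<le> norm l powr p / c" for l :: "real ^ 'm"
    using c by simp
  have w_le: "1 + norm l powr p \<le> (1 + c) * H l" for l
  proof -
    have "norm l powr p / c \<le> H l - 1" using h_ge[of l] unfolding H_def by simp
    then have "norm l powr p \<le> c * (H l - 1)" using c by (simp add: pos_divide_le_eq mult.commute)
    moreover have "1 \<le> H l"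
      using \<open>norm l powr p / c \<le> H l - 1\<close> powr_nonneg[of l] by linarith
    ultimately show ?thesis using c by (simp add: algebra_simps)
  qed
  have H_nonneg: "0 \<le> H l" for l
  proof -
    have "0 < (1 + c) * H l" using w_le[of l] powr_ge_zero[of "norm l" p] by linarith
    then show ?thesis using c by (simp add: zero_less_mult_iff)
  qed
  have norm_le: "norm l \<le> (1 + c) * H l" for l
    using norm_le_one_plus_powr[OF p, of l] w_le[of l] by linarith
  \<comment> \<open>|C| plus a bound for the integral of the negative part of \<open>h\<close>, plus
    the integral of the shift 1 + c.\<close>
  define K where "K = \<bar>C\<bar> + c * measure ?L (space ?L) + (1 + c) * measure ?L (space ?L)"
  have h_nn: "(\<integral>\<^sup>+x. ennreal (h (u n x)) \<partial>?L) \<le> ennreal (\<bar>C\<bar> + c * measure ?L (space ?L))" for n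
  proof (rule nn_integral_le_of_extended_integral_le)
    show "finite_measure ?L" by unfold_locales
    show "- c \<le> h (u n x)" for x
      using h_ge[of "u n x"] powr_nonneg[of "u n x"] by simp
    show "extended_integral ?L (\<lambda>x. h (u n x)) \<le> ereal C"
      by (rule order_trans[OF SUP_upper assms(8)]) simp
  qed (use c in auto)
  have H_nn: "(\<integral>\<^sup>+x. ennreal (H (u n x)) \<partial>?L) \<le> ennreal K" for n
  proof -
    \<comment> \<open>\<open>ennreal\<close> discards the negative part of \<open>h\<close>, so the
      shift can only be split off as an inequality, through the positive part.\<close>
    have "(\<integral>\<^sup>+x. ennreal (H (u n x)) \<partial>?L) \<le> (\<integral>\<^sup>+x. ennreal (h (u n x)) + ennreal (1 + c) \<partial>?L)"
    proof (intro nn_integral_mono)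
      fix x
      have "H (u n x) \<le> max 0 (h (u n x)) + (1 + c)" unfolding H_def by simp
      then have "ennreal (H (u n x)) \<le> ennreal (max 0 (h (u n x)) + (1 + c))" by (rule ennreal_leI)
      also have "\<dots> = ennreal (max 0 (h (u n x))) + ennreal (1 + c)" using c by (intro ennreal_plus) auto
      finally show "ennreal (H (u n x)) \<le> ennreal (h (u n x)) + ennreal (1 + c)"
        by (simp add: max_def ennreal_neg split: if_splits)
    qed
    also have "\<dots> = (\<integral>\<^sup>+x. ennreal (h (u n x)) \<partial>?L) + (\<integral>\<^sup>+x. ennreal (1 + c) \<partial>?L)"
      by (rule nn_integral_add) measurable
    also have "(\<integral>\<^sup>+x. ennreal (1 + c) \<partial>?L) = ennreal ((1 + c) * measure ?L (space ?L))"
      using c by (simp add: L.emeasure_eq_measure ennreal_mult)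
    also have "(\<integral>\<^sup>+x. ennreal (h (u n x)) \<partial>?L) + ennreal ((1 + c) * measure ?L (space ?L)) \<le>
        ennreal (\<bar>C\<bar> + c * measure ?L (space ?L)) + ennreal ((1 + c) * measure ?L (space ?L))"
      by (intro add_right_mono h_nn)
    also have "\<dots> = ennreal K"
      unfolding K_def using c by (intro ennreal_plus[symmetric]) auto
    finally show ?thesis .
  qed
  have K0: "0 \<le> K" unfolding K_def using c by simp
  have H_int: "integrable ?L (\<lambda>x. H (u n x))" for n
    using H_nonneg le_less_trans[OF H_nn[of n] ennreal_less_top]
    by (intro integrableI_bounded) auto
  have H_le: "(LINT x|?L. H (u n x)) \<le> K" for n
    using H_nn[of n] H_nonneg K0 by (subst (asm) nn_integral_eq_integral[OF H_int]) (auto simp: ennreal_le_iff)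
  obtain s1 Z where s1: "strict_mono s1" and Y1: "young_parametrization \<Omega> (\<lambda>k. u (s1 k)) Z"
    by (rule young_parametrization_exists[OF \<Omega> assms(2) u H_cont norm_le H_nonneg H_nn])
  obtain s2 \<mu>\<^sub>0 where s2: "strict_mono s2" and \<mu>\<^sub>0: "finite_measure \<mu>\<^sub>0"
    and s\<mu>\<^sub>0 [measurable_cong]: "sets \<mu>\<^sub>0 = sets borel"
    and \<mu>\<^sub>0_closure: "AE x in \<mu>\<^sub>0. x \<in> closure \<Omega>"
    and conc: "\<And>\<phi> :: real ^ 'd \<Rightarrow> real. continuous_on UNIV \<phi> \<Longrightarrow> bounded (range \<phi>) \<Longrightarrow>
      (\<lambda>k. LINT x|?L. H (u (s1 (s2 k)) x) * \<phi> x) \<longlonglongrightarrow>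
        (LINT z|(?L \<Otimes>\<^sub>M ?U). H (Z z) * \<phi> (fst z)) + (LINT x|\<mu>\<^sub>0. \<phi> x)"
    using concentration_measure_exists[OF \<Omega> assms(2) Y1 u H_cont H_nonneg H_int H_le] by blast
  interpret \<mu>\<^sub>0: finite_measure \<mu>\<^sub>0 by fact
  have sp\<mu>\<^sub>0: "space \<mu>\<^sub>0 = UNIV" using sets_eq_imp_space_eq[OF s\<mu>\<^sub>0] by simp
  define s where "s = s1 \<circ> s2"
  have Y: "young_parametrization \<Omega> (\<lambda>k. u (s k)) Z"
    using young_parametrization_subseq[OF Y1 s2] unfolding s_def by simp
  have Z [measurable]: "Z \<in> borel_measurable (borel \<Otimes>\<^sub>M ?U)"
    using Y unfolding young_parametrization_def by blast
  have Zx: "(\<lambda>\<omega>. Z (x, \<omega>)) \<in> borel_measurable ?U" for x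
    by (rule measurable_compose[OF measurable_Pair1' Z]) simp
  \<comment> \<open>A law for every x, with no exceptional set, as the definition of a Young measure
    demands.\<close>
  define \<nu> where "\<nu> x = distr ?U borel (\<lambda>\<omega>. Z (x, \<omega>))" for x
  have \<nu>_int: "(LINT l|\<nu> x. f l) = (LINT \<omega>|?U. f (Z (x, \<omega>)))"
    if "f \<in> borel_measurable borel" for x and f :: "real ^ 'm \<Rightarrow> real"
    unfolding \<nu>_def by (rule integral_distr[OF Zx that])
  have \<nu>_integrable: "integrable (\<nu> x) f \<longleftrightarrow> integrable ?U (\<lambda>\<omega>. f (Z (x, \<omega>)))"
    if "f \<in> borel_measurable borel" for x and f :: "real ^ 'm \<Rightarrow> real"
    unfolding \<nu>_def by (rule integrable_distr_eq[OF Zx that])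
  have \<nu>_young: "young_measure \<Omega> \<nu>"
    unfolding young_measure_def
  proof (intro conjI ballI allI impI)
    show "prob_space (\<nu> x)" "sets (\<nu> x) = sets borel" for x
      unfolding \<nu>_def using U.prob_space_distr[OF Zx] by simp_all
    fix g :: "real ^ 'm \<Rightarrow> real" assume "continuous_on UNIV g"
    then have g [measurable]: "g \<in> borel_measurable borel"
      by (rule borel_measurable_continuous_onI)
    have "(\<lambda>x. LINT \<omega>|?U. g (Z (x, \<omega>))) \<in> borel_measurable borel" by measurable
    then show "(\<lambda>x. LINT l|\<nu> x. g l) \<in> borel_measurable ?L"
      unfolding \<nu>_int[OF g] by (rule measurable_compose[OF measurable_lebesgue_on_borel])
  qed
  \<comment> \<open>Restriction makes the closure the underlying space and loses nothing, because
    the closure carries \<open>\<mu>\<^sub>0\<close>.\<close>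
  define \<mu> where "\<mu> = restrict_space \<mu>\<^sub>0 (closure \<Omega>)"
  have \<mu>_conc: "concentration_measure_on (closure \<Omega>) \<mu>"
    unfolding concentration_measure_on_def \<mu>_def
  proof
    show "finite_measure (restrict_space \<mu>\<^sub>0 (closure \<Omega>))"
      by (rule finite_measure_restrict_space) (auto simp: s\<mu>\<^sub>0 \<mu>\<^sub>0)
    show "sets (restrict_space \<mu>\<^sub>0 (closure \<Omega>)) = sets (restrict_space borel (closure \<Omega>))"
      by (rule sets_restrict_space_cong[OF s\<mu>\<^sub>0])
  qed
  note young = young_convergence[OF \<Omega> Y u H_cont H_nonneg H_int H_le]
  have part1: "(AE x in ?L. integrable (\<nu> x) f) \<and>
      weakly_convergent_L1 ?L (\<lambda>k x. f (u (s k) x)) (\<lambda>x. LINT l|\<nu> x. f l)"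
    if f: "continuous_on UNIV f" and lim: "((\<lambda>l. \<bar>f l\<bar> / (1 + norm l powr p)) \<longlongrightarrow> 0) at_infinity"
    for f :: "real ^ 'm \<Rightarrow> real"
  proof -
    have fm [measurable]: "f \<in> borel_measurable borel"
      using f by (rule borel_measurable_continuous_onI)
    have dom: "\<exists>R\<ge>0. \<forall>y. \<bar>f y\<bar> \<le> R \<or> \<bar>f y\<bar> \<le> \<epsilon> * H y" if "0 < \<epsilon>" for \<epsilon>
      by (rule vanishing_ratio_imp_dominated[OF f lim _ w_le _ that])
        (use c in \<open>auto simp: add_pos_nonneg\<close>)
    note fZ = young(2)[OF f dom]
    have AE: "AE x in ?L. integrable (\<nu> x) f"
      unfolding \<nu>_integrable[OF fm] by (rule LU.AE_integrable_fst'[OF fZ])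
    moreover have "weakly_convergent_L1 ?L (\<lambda>k x. f (u (s k) x)) (\<lambda>x. LINT l|\<nu> x. f l)"
      unfolding weakly_convergent_L1_def
    proof (intro conjI allI ballI impI)
      show "integrable ?L (\<lambda>x. f (u (s k) x))" for k
        by (rule young(1)[OF f dom])
      show "integrable ?L (\<lambda>x. LINT l|\<nu> x. f l)"
        unfolding \<nu>_int[OF fm] by (rule LU.integrable_fst'[OF fZ])
      fix g :: "real ^ 'd \<Rightarrow> real"
      assume g: "g \<in> borel_measurable ?L" and "\<exists>B. AE x in ?L. \<bar>g x\<bar> \<le> B"
      then obtain B where B: "AE x in ?L. \<bar>g x\<bar> \<le> B" by blast
      have "(LINT x|?L. (LINT l|\<nu> x. f l) * g x) = (LINT z|(?L \<Otimes>\<^sub>M ?U). f (Z z) * g (fst z))"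
        unfolding \<nu>_int[OF fm] using LU.integral_fst'[OF young(3)[OF f dom g B]] by simp
      then show "(\<lambda>k. LINT x|?L. f (u (s k) x) * g x) \<longlonglongrightarrow> (LINT x|?L. (LINT l|\<nu> x. f l) * g x)"
        using young(4)[OF f dom g B] by simp
    qed
    ultimately show ?thesis ..
  qed
  have "integrable (?L \<Otimes>\<^sub>M ?U) (\<lambda>z. H (Z z) * 1)"
    by (rule young_fatou(1)[OF \<Omega> Y u H_cont H_nonneg, where g="\<lambda>_. 1" and C=1 and a="\<lambda>_. K" and l=K])
      (use H_int H_le in simp_all)
  then have HZ: "integrable (?L \<Otimes>\<^sub>M ?U) (\<lambda>z. H (Z z))" by simp
  then have hZ: "integrable (?L \<Otimes>\<^sub>M ?U) (\<lambda>z. h (Z z))"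
    using Bochner_Integration.integrable_diff[OF HZ J.integrable_const[of "1 + c"]] unfolding H_def by simp
  have part2: "AE x in ?L. integrable (\<nu> x) h"
    unfolding \<nu>_integrable[OF h_meas] by (rule LU.AE_integrable_fst'[OF hZ])
  have part3: "integrable ?L (\<lambda>x. LINT l|\<nu> x. h l)"
    unfolding \<nu>_int[OF h_meas] by (rule LU.integrable_fst'[OF hZ])
  have part4: "(\<lambda>k. LINT x|?L. h (u (s k) x) * \<phi> x) \<longlonglongrightarrow>
      (LINT x|?L. (LINT l|\<nu> x. h l) * \<phi> x) + (LINT x|\<mu>. \<phi> x)"
    if \<phi>: "continuous_on (closure \<Omega>) \<phi>" for \<phi> :: "real ^ 'd \<Rightarrow> real"
  proof -
    \<comment> \<open>Outside the closure \<phi> is arbitrary. A bounded Tietze extension \<psi> is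
      a test function on the whole space and agrees with \<phi> wherever the integrals of the claim
      see it.\<close>
    have "bounded (\<phi> ` closure \<Omega>)"
      using \<phi> assms(2) by (intro compact_imp_bounded compact_continuous_image) (auto simp: compact_closure)
    then obtain B where B: "\<And>x. x \<in> closure \<Omega> \<Longrightarrow> norm (\<phi> x) \<le> B"
      unfolding bounded_iff by auto
    then have "\<And>x. x \<in> closure \<Omega> \<Longrightarrow> norm (\<phi> x) \<le> \<bar>B\<bar>" by force
    then obtain \<psi> where \<psi>: "continuous_on UNIV \<psi>" and eq: "\<And>x. x \<in> closure \<Omega> \<Longrightarrow> \<psi> x = \<phi> x"
      and \<psi>B: "\<And>x. \<bar>\<psi> x\<bar> \<le> \<bar>B\<bar>"
      using Tietze[OF \<phi>, of UNIV "\<bar>B\<bar>"] by auto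
    have \<psi>_bdd: "bounded (range \<psi>)" unfolding bounded_iff using \<psi>B by auto
    have \<psi>m [measurable]: "\<psi> \<in> borel_measurable borel"
      using \<psi> by (rule borel_measurable_continuous_onI)
    have \<psi>L [measurable]: "\<psi> \<in> borel_measurable ?L"
      by (rule measurable_compose[OF measurable_lebesgue_on_borel \<psi>m])
    have \<psi>J [measurable]: "(\<lambda>z. \<psi> (fst z)) \<in> borel_measurable (?L \<Otimes>\<^sub>M ?U)"
      by (rule measurable_compose[OF measurable_fst \<psi>L])
    have eq\<Omega>: "\<psi> x = \<phi> x" if "x \<in> \<Omega>" for x
      using eq closure_subset that by blast
    have \<psi>_int: "integrable ?L \<psi>"
      using \<psi>_bdd by (rule L.integrable_bounded_range[OF \<psi>L])
    \<comment> \<open>Returning from \<open>H\<close> to \<open>h\<close> subtracts (1 + c) times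
      the integral of \<psi>. The same amount is subtracted on the side of the Young measure, since
      each \<open>\<nu> x\<close> has mass 1, so the limit for \<open>H\<close> carries
      over.\<close>
    have left: "(LINT x|?L. h (u n x) * \<phi> x) = (LINT x|?L. H (u n x) * \<psi> x) - (1 + c) * (LINT x|?L. \<psi> x)" for n
    proof -
      have "(LINT x|?L. h (u n x) * \<phi> x) = (LINT x|?L. H (u n x) * \<psi> x - (1 + c) * \<psi> x)"
        by (intro Bochner_Integration.integral_cong)
          (auto simp: H_def eq\<Omega> space_restrict_space algebra_simps)
      also have "\<dots> = (LINT x|?L. H (u n x) * \<psi> x) - (1 + c) * (LINT x|?L. \<psi> x)"
        using integrable_mult_bounded[OF H_int \<psi>L \<psi>B] \<psi>_int by simp
      finally show ?thesis .
    qed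
    have hZ\<psi>: "integrable (?L \<Otimes>\<^sub>M ?U) (\<lambda>z. h (Z z) * \<psi> (fst z))"
      using integrable_mult_bounded[OF hZ \<psi>J \<psi>B] .
    have \<psi>J_int: "integrable (?L \<Otimes>\<^sub>M ?U) (\<lambda>z. \<psi> (fst z))"
      using \<psi>B by (intro J.integrable_const_bound[where B="\<bar>B\<bar>"]) auto
    have "(LINT x|?L. (LINT l|\<nu> x. h l) * \<phi> x) = (LINT x|?L. (LINT l|\<nu> x. h l) * \<psi> x)"
      by (intro Bochner_Integration.integral_cong) (auto simp: eq\<Omega> space_restrict_space)
    also have "\<dots> = (LINT z|(?L \<Otimes>\<^sub>M ?U). h (Z z) * \<psi> (fst z))"
      unfolding \<nu>_int[OF h_meas] using LU.integral_fst'[OF hZ\<psi>] by simp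
    also have "\<dots> = (LINT z|(?L \<Otimes>\<^sub>M ?U). H (Z z) * \<psi> (fst z) - (1 + c) * \<psi> (fst z))"
      by (intro Bochner_Integration.integral_cong) (auto simp: H_def algebra_simps)
    also have "\<dots> = (LINT z|(?L \<Otimes>\<^sub>M ?U). H (Z z) * \<psi> (fst z)) - (1 + c) * (LINT z|(?L \<Otimes>\<^sub>M ?U). \<psi> (fst z))"
      using integrable_mult_bounded[OF HZ \<psi>J \<psi>B] \<psi>J_int by simp
    also have "(LINT z|(?L \<Otimes>\<^sub>M ?U). \<psi> (fst z)) = (LINT x|?L. \<psi> x)"
      using LU.integral_fst'[OF \<psi>J_int] by (simp add: U.prob_space)
    finally have right: "(LINT x|?L. (LINT l|\<nu> x. h l) * \<phi> x) =
        (LINT z|(?L \<Otimes>\<^sub>M ?U). H (Z z) * \<psi> (fst z)) - (1 + c) * (LINT x|?L. \<psi> x)" .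
    have "(LINT x|\<mu>. \<phi> x) = (LINT x|\<mu>. \<psi> x)"
      unfolding \<mu>_def by (intro Bochner_Integration.integral_cong) (auto simp: eq space_restrict_space)
    also have "\<dots> = (LINT x|\<mu>\<^sub>0. indicator (closure \<Omega>) x *\<^sub>R \<psi> x)"
      unfolding \<mu>_def by (rule integral_restrict_space) (simp add: s\<mu>\<^sub>0 sp\<mu>\<^sub>0)
    also have "\<dots> = (LINT x|\<mu>\<^sub>0. \<psi> x)"
    proof (rule integral_cong_AE)
      have "(\<lambda>x. indicator (closure \<Omega>) x *\<^sub>R \<psi> x) \<in> borel_measurable borel"
        by (intro borel_measurable_scaleR borel_measurable_indicator \<psi>m) simp
      then show "(\<lambda>x. indicator (closure \<Omega>) x *\<^sub>R \<psi> x) \<in> borel_measurable \<mu>\<^sub>0"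
        "\<psi> \<in> borel_measurable \<mu>\<^sub>0"
        using \<psi>m by (simp_all add: measurable_cong_sets[OF s\<mu>\<^sub>0 refl])
      show "AE x in \<mu>\<^sub>0. indicator (closure \<Omega>) x *\<^sub>R \<psi> x = \<psi> x"
        using \<mu>\<^sub>0_closure by eventually_elim simp
    qed
    finally have bdry: "(LINT x|\<mu>. \<phi> x) = (LINT x|\<mu>\<^sub>0. \<psi> x)" .
    have "(\<lambda>k. (LINT x|?L. H (u (s k) x) * \<psi> x) - (1 + c) * (LINT x|?L. \<psi> x)) \<longlonglongrightarrow>
        (LINT z|(?L \<Otimes>\<^sub>M ?U). H (Z z) * \<psi> (fst z)) + (LINT x|\<mu>\<^sub>0. \<psi> x) - (1 + c) * (LINT x|?L. \<psi> x)"
      using conc[OF \<psi> \<psi>_bdd] unfolding s_def by (intro tendsto_intros) simp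
    then show ?thesis
      unfolding left right bdry by (simp add: algebra_simps)
  qed
  have "strict_mono s"
    unfolding s_def using s1 s2 by (rule strict_mono_o)
  then show ?thesis
    using \<nu>_young \<mu>_conc part1 part2 part3 part4 by blast
qed

end
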